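(* Let $K$ be a local field of odd residue characteristic, $L/K$ a ramified quadratic extension, and let $r\in \mathbf{N}$. The map $$B_{0}(r)\to \mathcal{I}^{0,r}\colon [(g,x)]\mapsto [(p_{r}(g),x)]^{0,r}$$ (where points of $B_0(r)$ are represented by pairs $(g,x)$ with $g\in P_0$ and $x\in[-\omega(\pi_L^{r}),\omega(\pi_L^{r})]$) is a well-defined bijection, equivariant with respect to the homomorphism $p_{r}\colon P_{0}\to P_{0}^{0,r}$.
   Context: $K$ is a non-archimedean local field of residue characteristic different from $2$, $L/K$ a quadratic ramified extension, $x\mapsto\bar x$ its non-trivial Galois automorphism, $\mathcal{O}_L,\mathfrak{m}_L,\pi_L$ the ring of integers, maximal ideal and a uniformiser of $L$, $\omega$ the (real-valued) valuation on $L$. $\mathrm{SU}_3^{L/K}(K)=\{g\in\mathrm{SL}_3(L)\mid{}^S\bar gg=\mathrm{Id}\}$, where ${}^Sg$ is the transpose along the anti-diagonal: $({}^Sg)_{ij}=g_{4-j,4-i}$. For matrices, $\omega(g)\ge m$ means $\omega(g_{ij})\ge m_{ij}$ for all $i,j$. Put $V_x=\begin{pmatrix} 0 & -\frac{x}{2} & -x \\ \frac{x}{2} & 0 & -\frac{x}{2} \\ x & \frac{x}{2} & 0 \end{pmatrix}$. Bruhat--Tits tree. For $x\in\mathbf{R}$ let $P_x=\{g\in\mathrm{SU}_3^{L/K}(K)\mid\omega(g)\ge V_x\}$. Let $T=\{\mathrm{diag}(x,x^{-1}\bar x,\bar x^{-1})\mid x\in L^\times\}$, $M=\{\begin{pmatrix}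 0 & 0 & x \\ 0 & -x^{-1}\bar x & 0 \\ \bar x^{-1} & 0 & 0 \end{pmatrix}\mid x\in L^\times\}$, $N=T\sqcup M$, and $\nu\colon N\to\mathrm{Aff}(\mathbf{R})$ the homomorphism sending the element of $M$ with parameter $x$ to the reflection through $-\omega(x)$ and the element of $T$ with parameter $x$ to the translation by $-2\omega(x)$. On $\mathrm{SU}_3^{L/K}(K)\times\mathbf{R}$ put $(g,x)\sim(h,y)$ iff there is $n\in N$ with $\nu(n)(x)=y$ and $g^{-1}hn\in P_x$. $\mathcal{I}$ is the quotient, with classes $[(g,x)]$; $\mathrm{SU}_3^{L/K}(K)$ acts by left multiplication on the first component. $\mathcal{I}$ carries an invariant metric restricting on each apartment $\{[(g,x)]\mid x\in\mathbf{R}\}$ to the metric of $\mathbf{R}$, scaled so that $0$ and $\omega(\pi_L)$ are at distance $1$. $B_0(r)$ is the closed ball of radius $r$ around $[(\mathrm{Id},0)]$; equivalently $B_0(r)=\{[(g,x)]\mid g\in P_0,\ x\in[-\omega(\pi_L^r),\omega(\pi_L^r)]\}$. Local version. The valuation and conjugation induce maps $\omega$ (with $\omega(0)=\infty$) and $x\mapsto\bar x$ on $\mathcal{O}_L/\mathfrak{m}_L^r$. For $x\in[-\omega(\pi_L^r),\omega(\pi_L^r)]$ let $P_x^{0,r}=\{g\in\mathrm{SL}_3(\mathcal{O}_L/\mathfrak{m}_L^r)\mid{}^S\bar gg=\mathrm{Id},\ \omega(g)\ge V_x\}$. Let $H^{0,r}$ (resp. $M^{0,r}$) be the set of matrices in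 $\mathrm{SL}_3(\mathcal{O}_L/\mathfrak{m}_L^r)$ of the form $\mathrm{diag}(x,x^{-1}\bar x,\bar x^{-1})$ (resp. $\begin{pmatrix} 0 & 0 & x \\ 0 & -x^{-1}\bar x & 0 \\ \bar x^{-1} & 0 & 0 \end{pmatrix}$) with $\omega(x)=0$, $N^{0,r}=H^{0,r}\sqcup M^{0,r}$, and let $\nu$ send $H^{0,r}$ to the identity of $\mathbf{R}$ and each element of $M^{0,r}$ to the reflection through $0$. On $P_0^{0,r}\times[-\omega(\pi_L^r),\omega(\pi_L^r)]$ put $(g,x)\sim_{0,r}(h,y)$ iff there is $n\in N^{0,r}$ with $\nu(n)(x)=y$ and $g^{-1}hn\in P_x^{0,r}$. $\mathcal{I}^{0,r}$ is the quotient, with classes $[(g,x)]^{0,r}$, on which $P_0^{0,r}$ acts by left multiplication on the first component. $p_r\colon P_0\to P_0^{0,r}$ is induced by reduction of coefficients $\mathcal{O}_L\to\mathcal{O}_L/\mathfrak{m}_L^r$. *)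

theory Defs
  imports "HOL-Analysis.Analysis" "HOL-Algebra.Algebra"
begin

section \<open>Local fields and ramified quadratic extensions\<close>

locale valued_field = field F for F (structure) +
  fixes v :: "'a \<Rightarrow> ereal"
  assumes v_zero: "v \<zero> = \<infinity>"
    and v_finite: "\<And>x. x \<in> carrier F \<Longrightarrow> x \<noteq> \<zero> \<Longrightarrow> \<bar>v x\<bar> \<noteq> \<infinity>"
    and v_mult: "\<And>x y. x \<in> carrier F \<Longrightarrow> y \<in> carrier F \<Longrightarrow> v (x \<otimes> y) = v x + v y"
    and v_add: "\<And>x y. x \<in> carrier F \<Longrightarrow> y \<in> carrier F \<Longrightarrow> min (v x) (v y) \<le> v (x \<oplus> y)"

definition val_ring :: "('a, 'm) ring_scheme \<Rightarrow> ('a \<Rightarrow> ereal) \<Rightarrow> ('a, 'm) ring_scheme" where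
  "val_ring F v = F\<lparr>carrier := {x \<in> carrier F. 0 \<le> v x}\<rparr>"

definition val_ideal :: "('a, 'm) ring_scheme \<Rightarrow> ('a \<Rightarrow> ereal) \<Rightarrow> 'a set" where
  "val_ideal F v = {x \<in> carrier F. 0 < v x}"

definition residue_field :: "('a, 'm) ring_scheme \<Rightarrow> ('a \<Rightarrow> ereal) \<Rightarrow> 'a set ring" where
  "residue_field F v = val_ring F v Quot val_ideal F v"

definition uniformiser :: "('a, 'm) ring_scheme \<Rightarrow> ('a \<Rightarrow> ereal) \<Rightarrow> 'a \<Rightarrow> bool" where
  "uniformiser F v p \<longleftrightarrow>
     p \<in> carrier (val_ring F v) \<and> val_ideal F v = PIdl\<^bsub>val_ring F v\<^esub> p"

text \<open>The valuation is not assumed to be normalised: its value group is \<open>c\<int>\<close> for some \<open>c > 0\<close>.\<close>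

locale local_field = valued_field +
  assumes discrete: "\<exists>c::real. 0 < c \<and>
      v ` (carrier F - {\<zero>}) = range (\<lambda>n::int. ereal (c * real_of_int n))"
    and complete: "\<And>s :: nat \<Rightarrow> 'a. range s \<subseteq> carrier F \<Longrightarrow>
      \<forall>C::real. \<exists>N. \<forall>m\<ge>N. \<forall>n\<ge>N. ereal C \<le> v (s m \<ominus> s n) \<Longrightarrow>
      \<exists>l\<in>carrier F. \<forall>C::real. \<exists>N. \<forall>n\<ge>N. ereal C \<le> v (s n \<ominus> l)"
    and finite_residue_field: "finite (carrier (residue_field F v))"

text \<open>
  The valuation of the local field \<open>K\<close> is the restriction of the valuation \<open>v\<close> of \<open>F\<close> (which is
  determined by that restriction, as \<open>K\<close> is complete). The assumption \<open>ramified\<close> says that the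
  ramification index, which is the index of \<open>v(K\<^sup>*)\<close> in \<open>v(F\<^sup>*)\<close>, is not 1.
\<close>

locale ramified_quadratic_extension = valued_field +
  fixes K :: "'a set" and \<sigma> :: "'a \<Rightarrow> 'a"
  assumes subfield: "subfield K F"
    and local_field: "local_field (F\<lparr>carrier := K\<rparr>) v"
    and odd_residue_char: "let k = residue_field (F\<lparr>carrier := K\<rparr>) v
      in \<one>\<^bsub>k\<^esub> \<oplus>\<^bsub>k\<^esub> \<one>\<^bsub>k\<^esub> \<noteq> \<zero>\<^bsub>k\<^esub>"
    and quadratic: "ring.dimension F 2 K (carrier F)"
    and ramified: "v ` (K - {\<zero>}) \<noteq> v ` (carrier F - {\<zero>})"
    and conj_iso: "\<sigma> \<in> ring_iso F F"
    and conj_fixes: "\<And>x. x \<in> K \<Longrightarrow> \<sigma> x = x"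
    and conj_nontrivial: "\<exists>x\<in>carrier F. \<sigma> x \<noteq> x"


section \<open>The truncated valuation rings\<close>

primrec ideal_pow :: "('a, 'm) ring_scheme \<Rightarrow> 'a set \<Rightarrow> nat \<Rightarrow> 'a set" where
  "ideal_pow R I 0 = carrier R"
| "ideal_pow R I (Suc n) = ideal_prod R I (ideal_pow R I n)"

definition trunc_ring :: "('a, 'm) ring_scheme \<Rightarrow> ('a \<Rightarrow> ereal) \<Rightarrow> nat \<Rightarrow> 'a set ring" where
  "trunc_ring L \<omega> r = val_ring L \<omega> Quot ideal_pow (val_ring L \<omega>) (val_ideal L \<omega>) r"

definition trunc_proj :: "('a, 'm) ring_scheme \<Rightarrow> ('a \<Rightarrow> ereal) \<Rightarrow> nat \<Rightarrow> 'a \<Rightarrow> 'a set" where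
  "trunc_proj L \<omega> r x = ideal_pow (val_ring L \<omega>) (val_ideal L \<omega>) r +>\<^bsub>val_ring L \<omega>\<^esub> x"

text \<open>The valuation is constant on every coset of the \<open>r\<close>-th power of the maximal ideal other than
  that power itself. The map which \<open>\<sigma>\<close> induces on cosets is the image map \<open>(`) \<sigma>\<close>.\<close>

definition trunc_val :: "('a, 'm) ring_scheme \<Rightarrow> ('a \<Rightarrow> ereal) \<Rightarrow> nat \<Rightarrow> 'a set \<Rightarrow> ereal" where
  "trunc_val L \<omega> r c = (if c = \<zero>\<^bsub>trunc_ring L \<omega> r\<^esub> then \<infinity> else the_elem (\<omega> ` c))"


section \<open>Three by three matrices over a ring given by a record\<close>

text \<open>In the numeral type \<open>3\<close> the indices 1, 2, 3 are pairwise distinct and \<open>3 = 0\<close>, so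
  \<open>i \<mapsto> 4 - i\<close> exchanges 1 and 3 and fixes 2.\<close>

definition mat3 :: "'a \<Rightarrow> 'a \<Rightarrow> 'a \<Rightarrow> 'a \<Rightarrow> 'a \<Rightarrow> 'a \<Rightarrow> 'a \<Rightarrow> 'a \<Rightarrow> 'a \<Rightarrow> 'a ^ 3 ^ 3" where
  "mat3 a b c
        d e f
        g h k = (\<chi> i j.
     if i = 1 then (if j = 1 then a else if j = 2 then b else c)
     else if i = 2 then (if j = 1 then d else if j = 2 then e else f)
     else (if j = 1 then g else if j = 2 then h else k))"

definition mat_mult :: "('a, 'm) ring_scheme \<Rightarrow> 'a ^ 3 ^ 3 \<Rightarrow> 'a ^ 3 ^ 3 \<Rightarrow> 'a ^ 3 ^ 3" where
  "mat_mult R A B = (\<chi> i j. \<Oplus>\<^bsub>R\<^esub>k\<in>UNIV. A $ i $ k \<otimes>\<^bsub>R\<^esub> B $ k $ j)"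

definition mat_one :: "('a, 'm) ring_scheme \<Rightarrow> 'a ^ 3 ^ 3" where
  "mat_one R = (\<chi> i j. if i = j then \<one>\<^bsub>R\<^esub> else \<zero>\<^bsub>R\<^esub>)"

definition mat_det :: "('a, 'm) ring_scheme \<Rightarrow> 'a ^ 3 ^ 3 \<Rightarrow> 'a" where
  "mat_det R A =
     (\<Oplus>\<^bsub>R\<^esub>p\<in>{p. p permutes UNIV}. [sign p] \<cdot>\<^bsub>R\<^esub> (\<Otimes>\<^bsub>R\<^esub>i\<in>UNIV. A $ i $ p i))"

definition SL3 :: "('a, 'm) ring_scheme \<Rightarrow> ('a ^ 3 ^ 3) monoid" where
  "SL3 R = \<lparr>carrier = {A. (\<forall>i j. A $ i $ j \<in> carrier R) \<and> mat_det R A = \<one>\<^bsub>R\<^esub>},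
            monoid.mult = mat_mult R, one = mat_one R\<rparr>"

definition anti_transpose :: "'a ^ 3 ^ 3 \<Rightarrow> 'a ^ 3 ^ 3" where
  "anti_transpose A = (\<chi> i j. A $ (4 - j) $ (4 - i))"

definition mat_map :: "('a \<Rightarrow> 'b) \<Rightarrow> 'a ^ 3 ^ 3 \<Rightarrow> 'b ^ 3 ^ 3" where
  "mat_map f A = (\<chi> i j. f (A $ i $ j))"

text \<open>\<open>SU3\<close>, \<open>P\<close>, \<open>T_mat\<close> and \<open>M_mat\<close> are used both for \<open>L\<close> with \<open>\<sigma>\<close> and \<open>\<omega>\<close>, and for the truncated
  valuation rings with the induced conjugation and valuation.\<close>

definition SU3 :: "('a, 'm) ring_scheme \<Rightarrow> ('a \<Rightarrow> 'a) \<Rightarrow> ('a ^ 3 ^ 3) set" where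
  "SU3 R \<sigma> = {g \<in> carrier (SL3 R). mat_mult R (anti_transpose (mat_map \<sigma> g)) g = mat_one R}"

definition V :: "real \<Rightarrow> real ^ 3 ^ 3" where
  "V x = mat3   0     (- x / 2)   (- x)
             (x / 2)      0     (- x / 2)
                x      (x / 2)      0"

definition P :: "('a, 'm) ring_scheme \<Rightarrow> ('a \<Rightarrow> 'a) \<Rightarrow> ('a \<Rightarrow> ereal) \<Rightarrow> real \<Rightarrow> ('a ^ 3 ^ 3) set" where
  "P R \<sigma> \<omega> x = {g \<in> SU3 R \<sigma>. \<forall>i j. ereal (V x $ i $ j) \<le> \<omega> (g $ i $ j)}"

definition T_mat :: "('a, 'm) ring_scheme \<Rightarrow> ('a \<Rightarrow> 'a) \<Rightarrow> 'a \<Rightarrow> 'a ^ 3 ^ 3" where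
  "T_mat R \<sigma> x = mat3 x       \<zero>\<^bsub>R\<^esub>                     \<zero>\<^bsub>R\<^esub>
                      \<zero>\<^bsub>R\<^esub>  (inv\<^bsub>R\<^esub> x \<otimes>\<^bsub>R\<^esub> \<sigma> x)         \<zero>\<^bsub>R\<^esub>
                      \<zero>\<^bsub>R\<^esub>      \<zero>\<^bsub>R\<^esub>               (inv\<^bsub>R\<^esub> (\<sigma> x))"

definition M_mat :: "('a, 'm) ring_scheme \<Rightarrow> ('a \<Rightarrow> 'a) \<Rightarrow> 'a \<Rightarrow> 'a ^ 3 ^ 3" where
  "M_mat R \<sigma> x = mat3   \<zero>\<^bsub>R\<^esub>              \<zero>\<^bsub>R\<^esub>                  x
                        \<zero>\<^bsub>R\<^esub>      (\<ominus>\<^bsub>R\<^esub> (inv\<^bsub>R\<^esub> x \<otimes>\<^bsub>R\<^esub> \<sigma> x))      \<zero>\<^bsub>R\<^esub>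
                    (inv\<^bsub>R\<^esub> (\<sigma> x))       \<zero>\<^bsub>R\<^esub>                  \<zero>\<^bsub>R\<^esub>"


section \<open>The gluing relation\<close>

definition glue_rel ::
  "('g, 'm) monoid_scheme \<Rightarrow> 'g set \<Rightarrow> real set \<Rightarrow> 'g set \<Rightarrow> ('g \<Rightarrow> real \<Rightarrow> real) \<Rightarrow>
   (real \<Rightarrow> 'g set) \<Rightarrow> (('g \<times> real) \<times> ('g \<times> real)) set" where
  "glue_rel G A I N \<nu> Q = {((g, x), (h, y)). g \<in> A \<and> h \<in> A \<and> x \<in> I \<and> y \<in> I \<and>
     (\<exists>n\<in>N. \<nu> n x = y \<and> inv\<^bsub>G\<^esub> g \<otimes>\<^bsub>G\<^esub> h \<otimes>\<^bsub>G\<^esub> n \<in> Q x)}"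

definition left_act :: "('g, 'm) monoid_scheme \<Rightarrow> 'g \<Rightarrow> ('g \<times> real) set \<Rightarrow> ('g \<times> real) set" where
  "left_act G k c = (\<lambda>(g, x). (k \<otimes>\<^bsub>G\<^esub> g, x)) ` c"


section \<open>The Bruhat--Tits tree\<close>

definition T_grp :: "('a, 'm) ring_scheme \<Rightarrow> ('a \<Rightarrow> 'a) \<Rightarrow> ('a ^ 3 ^ 3) set" where
  "T_grp L \<sigma> = T_mat L \<sigma> ` (carrier L - {\<zero>\<^bsub>L\<^esub>})"

definition M_set :: "('a, 'm) ring_scheme \<Rightarrow> ('a \<Rightarrow> 'a) \<Rightarrow> ('a ^ 3 ^ 3) set" where
  "M_set L \<sigma> = M_mat L \<sigma> ` (carrier L - {\<zero>\<^bsub>L\<^esub>})"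

definition N_grp :: "('a, 'm) ring_scheme \<Rightarrow> ('a \<Rightarrow> 'a) \<Rightarrow> ('a ^ 3 ^ 3) set" where
  "N_grp L \<sigma> = T_grp L \<sigma> \<union> M_set L \<sigma>"

definition reflection :: "real \<Rightarrow> real \<Rightarrow> real" where
  "reflection c y = 2 * c - y"

text \<open>The parameter of an element of \<open>M\<close> is its entry (1,3), that of an element of \<open>T\<close> is its
  entry (1,1).\<close>

definition nu :: "('a, 'm) ring_scheme \<Rightarrow> ('a \<Rightarrow> 'a) \<Rightarrow> ('a \<Rightarrow> ereal) \<Rightarrow> 'a ^ 3 ^ 3 \<Rightarrow> real \<Rightarrow> real" where
  "nu L \<sigma> \<omega> n y =
     (if n \<in> M_set L \<sigma> then reflection (- real_of_ereal (\<omega> (n $ 1 $ 3))) y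
      else y - 2 * real_of_ereal (\<omega> (n $ 1 $ 1)))"

definition tree_rel where
  "tree_rel L \<sigma> \<omega> =
     glue_rel (SL3 L) (SU3 L \<sigma>) UNIV (N_grp L \<sigma>) (nu L \<sigma> \<omega>) (P L \<sigma> \<omega>)"

definition tree where
  "tree L \<sigma> \<omega> = (SU3 L \<sigma> \<times> UNIV) // tree_rel L \<sigma> \<omega>"

definition tree_class where
  "tree_class L \<sigma> \<omega> g x = tree_rel L \<sigma> \<omega> `` {(g, x)}"

text \<open>
  Two points of the tree lie in a common apartment, and their distance is the one measured, on the
  scale in which 0 and \<open>\<omega>(p)\<close> are at distance 1, in any apartment containing them. So all the
  elements of the following set are equal, and \<open>Inf\<close> merely selects their common value.
\<close>

definition tree_dist where
  "tree_dist L \<sigma> \<omega> p a b = Inf {ereal (\<bar>x - y\<bar> / real_of_ereal (\<omega> p)) | g x y.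
     g \<in> SU3 L \<sigma> \<and> a = tree_class L \<sigma> \<omega> g x \<and> b = tree_class L \<sigma> \<omega> g y}"

definition tree_ball where
  "tree_ball L \<sigma> \<omega> p r = {b \<in> tree L \<sigma> \<omega>.
     tree_dist L \<sigma> \<omega> p (tree_class L \<sigma> \<omega> \<one>\<^bsub>SL3 L\<^esub> 0) b \<le> ereal (real r)}"


section \<open>The local version\<close>

definition trunc_interval ::
  "('a, 'm) ring_scheme \<Rightarrow> ('a \<Rightarrow> ereal) \<Rightarrow> 'a \<Rightarrow> nat \<Rightarrow> real set" where
  "trunc_interval L \<omega> p r =
     {- real_of_ereal (\<omega> (p [^]\<^bsub>L\<^esub> r)) .. real_of_ereal (\<omega> (p [^]\<^bsub>L\<^esub> r))}"

definition P_loc where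
  "P_loc L \<sigma> \<omega> r x = P (trunc_ring L \<omega> r) ((`) \<sigma>) (trunc_val L \<omega> r) x"

definition H_loc where
  "H_loc L \<sigma> \<omega> r = carrier (SL3 (trunc_ring L \<omega> r)) \<inter>
     T_mat (trunc_ring L \<omega> r) ((`) \<sigma>) `
       {x \<in> carrier (trunc_ring L \<omega> r). trunc_val L \<omega> r x = 0}"

definition M_loc where
  "M_loc L \<sigma> \<omega> r = carrier (SL3 (trunc_ring L \<omega> r)) \<inter>
     M_mat (trunc_ring L \<omega> r) ((`) \<sigma>) `
       {x \<in> carrier (trunc_ring L \<omega> r). trunc_val L \<omega> r x = 0}"

definition N_loc where
  "N_loc L \<sigma> \<omega> r = H_loc L \<sigma> \<omega> r \<union> M_loc L \<sigma> \<omega> r"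

definition nu_loc where
  "nu_loc L \<sigma> \<omega> r n y = (if n \<in> M_loc L \<sigma> \<omega> r then reflection 0 y else y)"

definition loc_rel where
  "loc_rel L \<sigma> \<omega> p r =
     glue_rel (SL3 (trunc_ring L \<omega> r)) (P_loc L \<sigma> \<omega> r 0) (trunc_interval L \<omega> p r)
       (N_loc L \<sigma> \<omega> r) (nu_loc L \<sigma> \<omega> r) (P_loc L \<sigma> \<omega> r)"

definition loc where
  "loc L \<sigma> \<omega> p r = (P_loc L \<sigma> \<omega> r 0 \<times> trunc_interval L \<omega> p r) // loc_rel L \<sigma> \<omega> p r"

definition loc_class where
  "loc_class L \<sigma> \<omega> p r g x = loc_rel L \<sigma> \<omega> p r `` {(g, x)}"

definition p_red where
  "p_red L \<omega> r g = mat_map (trunc_proj L \<omega> r) g"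

end

theory Submission
  imports Defs "HOL-Decision_Procs.Commutative_Ring"
begin

text \<open>
  Put \<open>E x = (x/2, 0, -x/2)\<close>, so that \<open>V x\<close> has entries \<open>E x j - E x i\<close>. Multiplying by an element \<open>n\<close>
  of \<open>N\<close> on the right moves the bound for \<open>P x\<close> on the \<open>j\<close>-th column by \<open>E (\<nu> n x) j - E x j\<close> (up to
  a permutation of the columns), so \<open>(g, x)\<close> and \<open>(h, y)\<close> are glued iff \<open>x\<close> and \<open>y\<close> lie in one orbit of \<open>N\<close>
  and the entries of \<open>q = g\<^sup>-\<^sup>1 h\<close> satisfy \<open>E y j - E x i \<le> \<omega> (q i j)\<close>. If \<open>q\<close> is integral, this forces
  \<open>\<bar>x\<bar> = \<bar>y\<bar>\<close>: otherwise all the entries of a column of \<open>q\<close> or of \<open>q\<^sup>-\<^sup>1\<close> would have positive valuation.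
  Hence elements of \<open>N\<close> with unit parameter suffice, the balls are described as claimed, and as the
  bounds are at most \<open>\<omega> (\<pi>\<^sup>r)\<close> they can be read off modulo \<open>\<pi>\<^sup>r\<close>.

  It remains to see that \<open>P\<^sub>0\<close> maps onto \<open>P\<^sub>0\<^sup>0\<^sup>,\<^sup>r\<close>. A unitary matrix over the truncated ring whose entry
  (1,1) is a unit is a product of a lower unipotent, a diagonal and an upper unipotent unitary
  matrix; the entry (1,1) or (3,1) always is a unit. The unipotent matrices are parametrised by pairs
  with \<open>c + \<sigma> c + b \<sigma> b = 0\<close>, and such a pair lifts because 2 is invertible.

  That \<open>\<sigma>\<close> preserves \<open>\<omega>\<close> does not need completeness: for \<open>x\<close> with \<open>\<omega> x \<notin> \<omega> (K\<^sup>*)\<close> one has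
  \<open>\<omega> (b x + a) = min (\<omega> (b x)) (\<omega> a)\<close> for \<open>a, b \<in> K\<close>, and \<open>\<sigma> x = t - x\<close> with \<open>t \<in> K\<close>.
\<close>


section \<open>Matrices of size three over a commutative ring\<close>

lemma three_simps [simp]: "(4::3) - 2 = 2" "(4::3) - 3 = 1" "(1::3) \<noteq> 3" "(3::3) \<noteq> 1"
    "(1::3) \<noteq> 2" "(2::3) \<noteq> 1" "(2::3) \<noteq> 3" "(3::3) \<noteq> 2"
  by simp_all

lemma four_minus_four_minus [simp]: "4 - (4 - i) = (i::3)"
  by simp

lemma mat3_nth [simp]:
  "mat3 a b c d e f g h k $ 1 $ 1 = a" "mat3 a b c d e f g h k $ 1 $ 2 = b" "mat3 a b c d e f g h k $ 1 $ 3 = c"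
  "mat3 a b c d e f g h k $ 2 $ 1 = d" "mat3 a b c d e f g h k $ 2 $ 2 = e" "mat3 a b c d e f g h k $ 2 $ 3 = f"
  "mat3 a b c d e f g h k $ 3 $ 1 = g" "mat3 a b c d e f g h k $ 3 $ 2 = h" "mat3 a b c d e f g h k $ 3 $ 3 = k"
  by (simp_all add: mat3_def)

lemma mat_map_nth [simp]: "mat_map f A $ i $ j = f (A $ i $ j)"
  by (simp add: mat_map_def)

lemma anti_transpose_nth [simp]: "anti_transpose A $ i $ j = A $ (4 - j) $ (4 - i)"
  by (simp add: anti_transpose_def)

lemma mat_one_nth [simp]: "mat_one R $ i $ j = (if i = j then \<one>\<^bsub>R\<^esub> else \<zero>\<^bsub>R\<^esub>)"
  by (simp add: mat_one_def)

lemma mat3_eq_iff: "A = B \<longleftrightarrow> (\<forall>i j. A $ i $ j = B $ i $ j)" for A B :: "'a ^ 3 ^ 3"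
  by (simp add: vec_eq_iff)

lemma permutations_3:
  "{p. p permutes (UNIV :: 3 set)} =
     {id, Transposition.transpose 2 3, Transposition.transpose 1 2, Transposition.transpose 1 2 \<circ> Transposition.transpose 2 3,
      Transposition.transpose 1 3, Transposition.transpose 1 3 \<circ> Transposition.transpose 2 3}"
proof -
  \<comment> \<open>\<open>permutes_insert\<close> describes permutations by pairs of an image point
    and a permutation of the rest. These rules peel off the possible image points one at a time
    until the set is explicit.\<close>
  have image_pairs: "f ` {(b, p). b \<in> insert a B \<and> p \<in> C} = (\<lambda>p. f (a, p)) ` C \<union> f ` {(b, p). b \<in> B \<and> p \<in> C}"
    "f ` {(b, p). b \<in> {} \<and> p \<in> C} = {}"
    for f :: "3 \<times> (3 \<Rightarrow> 3) \<Rightarrow> 3 \<Rightarrow> 3" and a :: 3 and B C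
    by auto
  show ?thesis
    unfolding UNIV_3 permutes_insert permutes_sing image_pairs by (simp add: insert_commute)
qed

text \<open>Sarrus' rule. The nine entries are separate arguments so that the interpretation of a
  polynomial term can be recognised as a determinant.\<close>

definition det3 where
  "det3 R a b c d e f g h k =
     (a \<otimes>\<^bsub>R\<^esub> e \<otimes>\<^bsub>R\<^esub> k \<oplus>\<^bsub>R\<^esub> b \<otimes>\<^bsub>R\<^esub> f \<otimes>\<^bsub>R\<^esub> g \<oplus>\<^bsub>R\<^esub> c \<otimes>\<^bsub>R\<^esub> d \<otimes>\<^bsub>R\<^esub> h) \<ominus>\<^bsub>R\<^esub>
     (a \<otimes>\<^bsub>R\<^esub> f \<otimes>\<^bsub>R\<^esub> h \<oplus>\<^bsub>R\<^esub> b \<otimes>\<^bsub>R\<^esub> d \<otimes>\<^bsub>R\<^esub> k \<oplus>\<^bsub>R\<^esub> c \<otimes>\<^bsub>R\<^esub> e \<otimes>\<^bsub>R\<^esub> g)"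

definition dot3 where
  "dot3 R a b c d e f = a \<otimes>\<^bsub>R\<^esub> d \<oplus>\<^bsub>R\<^esub> b \<otimes>\<^bsub>R\<^esub> e \<oplus>\<^bsub>R\<^esub> c \<otimes>\<^bsub>R\<^esub> f"

definition mats :: "('a, 'm) ring_scheme \<Rightarrow> ('a ^ 3 ^ 3) set" where
  "mats R = {A. \<forall>i j. A $ i $ j \<in> carrier R}"

text \<open>The adjugate. The sign of a cofactor is encoded in the order of the two columns of its
  minor.\<close>

definition adj :: "('a, 'm) ring_scheme \<Rightarrow> 'a ^ 3 ^ 3 \<Rightarrow> 'a ^ 3 ^ 3" where
  "adj R A = (let m = (\<lambda>i j k l. A $ i $ k \<otimes>\<^bsub>R\<^esub> A $ j $ l \<ominus>\<^bsub>R\<^esub> A $ i $ l \<otimes>\<^bsub>R\<^esub> A $ j $ k) in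
     mat3 (m 2 3 2 3) (m 1 3 3 2) (m 1 2 2 3)
          (m 2 3 3 1) (m 1 3 1 3) (m 1 2 3 1)
          (m 2 3 1 2) (m 1 3 2 1) (m 1 2 1 2))"

text \<open>Reified counterparts of \<open>det3\<close> and \<open>dot3\<close>: the polynomial identities behind the multiplicativity
  of the determinant and the adjugate are decided by comparing normal forms of these terms.\<close>

definition polex_det where
  "polex_det a b c d e f g h k =
     Sub (Add (Add (Mul (Mul a e) k) (Mul (Mul b f) g)) (Mul (Mul c d) h))
         (Add (Add (Mul (Mul a f) h) (Mul (Mul b d) k)) (Mul (Mul c e) g))"

definition polex_dot where
  "polex_dot a b c d e f = Add (Add (Mul a d) (Mul b e)) (Mul c f)"

text \<open>Variables 0 to 8 stand for the entries of the first matrix, row by row, and 9 to 17 for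
  those of the second.\<close>

lemma norm_polex_det_mult:
  "Commutative_Ring.norm (polex_det
     (polex_dot (Var 0) (Var 1) (Var 2) (Var 9) (Var 12) (Var 15))
     (polex_dot (Var 0) (Var 1) (Var 2) (Var 10) (Var 13) (Var 16))
     (polex_dot (Var 0) (Var 1) (Var 2) (Var 11) (Var 14) (Var 17))
     (polex_dot (Var 3) (Var 4) (Var 5) (Var 9) (Var 12) (Var 15))
     (polex_dot (Var 3) (Var 4) (Var 5) (Var 10) (Var 13) (Var 16))
     (polex_dot (Var 3) (Var 4) (Var 5) (Var 11) (Var 14) (Var 17))
     (polex_dot (Var 6) (Var 7) (Var 8) (Var 9) (Var 12) (Var 15))
     (polex_dot (Var 6) (Var 7) (Var 8) (Var 10) (Var 13) (Var 16))
     (polex_dot (Var 6) (Var 7) (Var 8) (Var 11) (Var 14) (Var 17))) =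
   Commutative_Ring.norm (Mul
     (polex_det (Var 0) (Var 1) (Var 2) (Var 3) (Var 4) (Var 5) (Var 6) (Var 7) (Var 8))
     (polex_det (Var 9) (Var 10) (Var 11) (Var 12) (Var 13) (Var 14) (Var 15) (Var 16) (Var 17)))"
  by (simp add: polex_dot_def polex_det_def mkPX_def mkPinj_def sub_def)

lemma SL3_simps [simp]:
  "A \<otimes>\<^bsub>SL3 R\<^esub> B = mat_mult R A B" "\<one>\<^bsub>SL3 R\<^esub> = mat_one R"
  by (simp_all add: SL3_def)

context cring
begin

lemma Ipolex_det [simp]:
  "Ipolex l (polex_det a b c d e f g h k) =
     det3 R (Ipolex l a) (Ipolex l b) (Ipolex l c) (Ipolex l d) (Ipolex l e) (Ipolex l f)
       (Ipolex l g) (Ipolex l h) (Ipolex l k)"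
  by (simp add: polex_det_def det3_def)

lemma Ipolex_dot [simp]:
  "Ipolex l (polex_dot a b c d e f) =
     dot3 R (Ipolex l a) (Ipolex l b) (Ipolex l c) (Ipolex l d) (Ipolex l e) (Ipolex l f)"
  by (simp add: polex_dot_def dot3_def)

lemma mats_nth [simp]: "A \<in> mats R \<Longrightarrow> A $ i $ j \<in> carrier R"
  by (simp add: mats_def)

lemma mat_mult_nth:
  assumes "A \<in> mats R" "B \<in> mats R"
  shows "mat_mult R A B $ i $ j =
    dot3 R (A $ i $ 1) (A $ i $ 2) (A $ i $ 3) (B $ 1 $ j) (B $ 2 $ j) (B $ 3 $ j)"
proof -
  have "mat_mult R A B $ i $ j = (\<Oplus>k\<in>{1, 2, 3}. A $ i $ k \<otimes> B $ k $ j)"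
    by (simp only: mat_mult_def vec_lambda_beta UNIV_3)
  also have "\<dots> = dot3 R (A $ i $ 1) (A $ i $ 2) (A $ i $ 3) (B $ 1 $ j) (B $ 2 $ j) (B $ 3 $ j)"
    using assms by (simp add: dot3_def Pi_iff a_assoc)
  finally show ?thesis .
qed

lemma mat_det_det3:
  assumes "A \<in> mats R"
  shows "mat_det R A = det3 R (A $ 1 $ 1) (A $ 1 $ 2) (A $ 1 $ 3) (A $ 2 $ 1) (A $ 2 $ 2) (A $ 2 $ 3)
    (A $ 3 $ 1) (A $ 3 $ 2) (A $ 3 $ 3)"
proof -
  let ?F = "\<lambda>p. [sign p] \<cdot> (\<Otimes>i\<in>UNIV. A $ i $ p i)"
  have prod: "(\<Otimes>i\<in>UNIV. A $ i $ p i) = A $ 1 $ p 1 \<otimes> A $ 2 $ p 2 \<otimes> A $ 3 $ p 3" for p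
    unfolding UNIV_3 using assms by (simp add: Pi_iff m_assoc)
  have F: "?F p \<in> carrier R" for p
    using assms by (simp add: prod)
  \<comment> \<open>A sum over an explicit set unfolds only once its elements are known to be
    distinct, so the six permutations are separated by their values.\<close>
  have neqI: "f \<noteq> g" if "f 1 \<noteq> g 1 \<or> f 2 \<noteq> g 2 \<or> f 3 \<noteq> g 3" for f g :: "3 \<Rightarrow> 3"
    using that by auto
  have ne: "id \<noteq> Transposition.transpose 2 (3::3)" "id \<noteq> Transposition.transpose 1 (2::3)" "id \<noteq> Transposition.transpose 1 (2::3) \<circ> Transposition.transpose 2 3"
     "id \<noteq> Transposition.transpose 1 (3::3)" "id \<noteq> Transposition.transpose 1 (3::3) \<circ> Transposition.transpose 2 3"
     "Transposition.transpose 2 3 \<noteq> Transposition.transpose 1 (2::3)" "Transposition.transpose 2 3 \<noteq> Transposition.transpose 1 (2::3) \<circ> Transposition.transpose 2 3"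
     "Transposition.transpose 2 3 \<noteq> Transposition.transpose 1 (3::3)" "Transposition.transpose 2 3 \<noteq> Transposition.transpose 1 (3::3) \<circ> Transposition.transpose 2 3"
     "Transposition.transpose 1 2 \<noteq> Transposition.transpose 1 (2::3) \<circ> Transposition.transpose 2 3"
     "Transposition.transpose 1 2 \<noteq> Transposition.transpose 1 (3::3)" "Transposition.transpose 1 2 \<noteq> Transposition.transpose 1 (3::3) \<circ> Transposition.transpose 2 3"
     "Transposition.transpose 1 2 \<circ> Transposition.transpose 2 3 \<noteq> Transposition.transpose 1 (3::3)"
     "Transposition.transpose 1 2 \<circ> Transposition.transpose 2 3 \<noteq> Transposition.transpose 1 (3::3) \<circ> Transposition.transpose 2 3"
     "Transposition.transpose 1 3 \<noteq> Transposition.transpose 1 (3::3) \<circ> Transposition.transpose 2 3"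
    by (rule neqI; simp add: Transposition.transpose_def)+
  have sgn: "sign (Transposition.transpose 1 (2::3) \<circ> Transposition.transpose 2 3) = 1" "sign (Transposition.transpose 1 (3::3) \<circ> Transposition.transpose 2 3) = 1"
    "sign (Transposition.transpose 1 (2::3)) = -1" "sign (Transposition.transpose 1 (3::3)) = -1" "sign (Transposition.transpose 2 (3::3)) = -1"
    by (simp_all add: sign_compose sign_swap_id permutation_swap_id)
  have one: "[(1::int)] \<cdot> x = x" "[(-1::int)] \<cdot> x = \<ominus> x" if "x \<in> carrier R" for x
    using that by (simp_all add: add.int_pow_neg add.int_pow_1 del: add.int_pow_neg_int)
  have "mat_det R A = ?F id \<oplus> (?F (Transposition.transpose 2 3) \<oplus> (?F (Transposition.transpose 1 2) \<oplus>
      (?F (Transposition.transpose 1 2 \<circ> Transposition.transpose 2 3) \<oplus> (?F (Transposition.transpose 1 3) \<oplus> ?F (Transposition.transpose 1 3 \<circ> Transposition.transpose 2 3)))))"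
    unfolding mat_det_def permutations_3
    using assms by (simp add: ne F Pi_iff del: id_apply)
  also have "\<dots> = det3 R (A $ 1 $ 1) (A $ 1 $ 2) (A $ 1 $ 3) (A $ 2 $ 1) (A $ 2 $ 2) (A $ 2 $ 3)
    (A $ 3 $ 1) (A $ 3 $ 2) (A $ 3 $ 3)"
    using assms unfolding sgn sign_id prod
    by (simp add: one det3_def Transposition.transpose_def minus_eq minus_add a_ac)
  finally show ?thesis .
qed


lemma mats_mult [simp]:
  assumes "A \<in> mats R" "B \<in> mats R"
  shows "mat_mult R A B \<in> mats R"
proof -
  have "mat_mult R A B $ i $ j \<in> carrier R" for i j
    using assms by (simp add: mat_mult_nth dot3_def)
  then show ?thesis
    unfolding mats_def by blast
qed

lemma mats_one [simp]: "mat_one R \<in> mats R"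
  unfolding mats_def by simp

lemma mat_det_closed [simp]: "A \<in> mats R \<Longrightarrow> mat_det R A \<in> carrier R"
  by (simp add: mat_det_det3 det3_def)

lemma mat_mult_assoc:
  assumes "A \<in> mats R" "B \<in> mats R" "C \<in> mats R"
  shows "mat_mult R (mat_mult R A B) C = mat_mult R A (mat_mult R B C)"
  unfolding mat3_eq_iff using assms
  by (simp add: mat_mult_nth dot3_def l_distr r_distr m_assoc a_ac)

lemma mat_mult_one [simp]:
  assumes "A \<in> mats R"
  shows "mat_mult R (mat_one R) A = A" "mat_mult R A (mat_one R) = A"
  unfolding mat3_eq_iff forall_3 using assms by (simp_all add: mat_mult_nth dot3_def)

lemma mat_det_one [simp]: "mat_det R (mat_one R) = \<one>"
  by (simp add: mat_det_det3 det3_def minus_eq)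

lemma mat_det_mult:
  assumes A: "A \<in> mats R" and B: "B \<in> mats R"
  shows "mat_det R (mat_mult R A B) = mat_det R A \<otimes> mat_det R B"
proof -
  let ?l = "[A $ 1 $ 1, A $ 1 $ 2, A $ 1 $ 3, A $ 2 $ 1, A $ 2 $ 2, A $ 2 $ 3, A $ 3 $ 1, A $ 3 $ 2, A $ 3 $ 3,
    B $ 1 $ 1, B $ 1 $ 2, B $ 1 $ 3, B $ 2 $ 1, B $ 2 $ 2, B $ 2 $ 3, B $ 3 $ 1, B $ 3 $ 2, B $ 3 $ 3]"
  have "in_carrier ?l"
    using A B by (simp add: in_carrier_def)
  note norm_eq[OF this norm_polex_det_mult]
  then show ?thesis
    using A B by (simp add: mat_det_det3 mat_mult_nth)
qed

lemma adj_closed [simp]: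
  assumes "A \<in> mats R"
  shows "adj R A \<in> mats R"
proof -
  have "\<forall>i j. adj R A $ i $ j \<in> carrier R"
    using assms by (simp add: adj_def forall_3)
  then show ?thesis
    unfolding mats_def by blast
qed

lemma mat_mult_adj:
  assumes A: "A \<in> mats R"
  shows "mat_mult R A (adj R A) $ i $ j = (if i = j then mat_det R A else \<zero>)"
proof -
  let ?l = "[A $ 1 $ 1, A $ 1 $ 2, A $ 1 $ 3, A $ 2 $ 1, A $ 2 $ 2, A $ 2 $ 3, A $ 3 $ 1, A $ 3 $ 2, A $ 3 $ 3]"
  \<comment> \<open>Entry (i, k) is variable \<open>3 * i + k - 4\<close>, so \<open>?m\<close>
    reifies the minors in \<open>adj\<close>; the row index of \<open>?d\<close> starts at
    0.\<close>
  let ?m = "\<lambda>i j k l. Sub (Mul (Var (3 * i + k - 4)) (Var (3 * j + l - 4))) (Mul (Var (3 * i + l - 4)) (Var (3 * j + k - 4)))"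
  let ?d = "\<lambda>i. polex_dot (Var (3 * i)) (Var (3 * i + 1)) (Var (3 * i + 2))"
  let ?det = "polex_det (Var 0) (Var 1) (Var 2) (Var 3) (Var 4) (Var 5) (Var 6) (Var 7) (Var 8)"
  have l: "in_carrier ?l"
    using A by (simp add: in_carrier_def)
  note n = norm_eq[OF l]
  have "Ipolex ?l (?d 0 (?m 2 3 2 3) (?m 2 3 3 1) (?m 2 3 1 2)) = Ipolex ?l ?det"
    "Ipolex ?l (?d 1 (?m 2 3 2 3) (?m 2 3 3 1) (?m 2 3 1 2)) = Ipolex ?l (Const 0)"
    "Ipolex ?l (?d 2 (?m 2 3 2 3) (?m 2 3 3 1) (?m 2 3 1 2)) = Ipolex ?l (Const 0)"
    "Ipolex ?l (?d 0 (?m 1 3 3 2) (?m 1 3 1 3) (?m 1 3 2 1)) = Ipolex ?l (Const 0)"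
    "Ipolex ?l (?d 1 (?m 1 3 3 2) (?m 1 3 1 3) (?m 1 3 2 1)) = Ipolex ?l ?det"
    "Ipolex ?l (?d 2 (?m 1 3 3 2) (?m 1 3 1 3) (?m 1 3 2 1)) = Ipolex ?l (Const 0)"
    "Ipolex ?l (?d 0 (?m 1 2 2 3) (?m 1 2 3 1) (?m 1 2 1 2)) = Ipolex ?l (Const 0)"
    "Ipolex ?l (?d 1 (?m 1 2 2 3) (?m 1 2 3 1) (?m 1 2 1 2)) = Ipolex ?l (Const 0)"
    "Ipolex ?l (?d 2 (?m 1 2 2 3) (?m 1 2 3 1) (?m 1 2 1 2)) = Ipolex ?l ?det"
    by (rule n, simp add: polex_dot_def polex_det_def mkPX_def mkPinj_def sub_def)+
  moreover have "mat_mult R A (adj R A) $ i $ j = dot3 R (A $ i $ 1) (A $ i $ 2) (A $ i $ 3)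
      (adj R A $ 1 $ j) (adj R A $ 2 $ j) (adj R A $ 3 $ j)"
    using A by (simp add: mat_mult_nth)
  ultimately show ?thesis
    using exhaust_3[of i] exhaust_3[of j]
    by (elim disjE) (simp_all add: mat_det_det3[OF A] adj_def)
qed

lemma SL3_carrier: "carrier (SL3 R) = {A \<in> mats R. mat_det R A = \<one>}"
  unfolding SL3_def mats_def by simp

lemma SL3_group: "group (SL3 R)"
proof (rule groupI)
  fix A assume "A \<in> carrier (SL3 R)"
  then have A: "A \<in> mats R" "mat_det R A = \<one>"
    by (auto simp: SL3_carrier)
  have right: "mat_mult R A (adj R A) = mat_one R" if "A \<in> mats R" "mat_det R A = \<one>" for A
    using that by (simp add: mat3_eq_iff mat_mult_adj)
  define B where "B = adj R A"
  have B: "B \<in> mats R"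
    using A by (simp add: B_def)
  have AB: "mat_mult R A B = mat_one R"
    using right A by (simp add: B_def)
  have detB: "mat_det R B = \<one>"
    using mat_det_mult[OF A(1) B] AB A B by simp
  \<comment> \<open>The adjugate identity is available on the right only. As \<open>B\<close> has
    determinant 1, it too has a right inverse, and a right inverse of \<open>A\<close> that is
    itself right invertible is also a left inverse.\<close>
  have "mat_mult R B A = mat_mult R (mat_mult R B A) (mat_mult R B (adj R B))"
    using right[OF B detB] A B by simp
  also have "\<dots> = mat_mult R B (mat_mult R (mat_mult R A B) (adj R B))"
    using A B by (simp add: mat_mult_assoc)
  also have "\<dots> = mat_one R"
    using right[OF B detB] B AB by simp
  finally show "\<exists>y\<in>carrier (SL3 R). y \<otimes>\<^bsub>SL3 R\<^esub> A = \<one>\<^bsub>SL3 R\<^esub>"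
    using B detB by (auto simp: SL3_carrier)
qed (auto simp: SL3_carrier mat_det_mult mat_mult_assoc)

end


section \<open>The special unitary group over a ring with involution\<close>

text \<open>The adjoint with respect to the sesquilinear form that pairs coordinate i with
  coordinate 4 - i; on \<open>SU3\<close> it is the inverse.\<close>

definition dagger :: "('a \<Rightarrow> 'a) \<Rightarrow> 'a ^ 3 ^ 3 \<Rightarrow> 'a ^ 3 ^ 3" where
  "dagger \<tau> A = anti_transpose (mat_map \<tau> A)"

lemma dagger_nth [simp]: "dagger \<tau> A $ i $ j = \<tau> (A $ (4 - j) $ (4 - i))"
  by (simp add: dagger_def)

text \<open>The entry (2,3) is the one that unitarity forces, see
  \<open>SU3_unipotent\<close>.\<close>

definition U_mat :: "('a, 'm) ring_scheme \<Rightarrow> ('a \<Rightarrow> 'a) \<Rightarrow> 'a \<Rightarrow> 'a \<Rightarrow> 'a ^ 3 ^ 3" where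
  "U_mat R \<tau> b c = mat3 \<one>\<^bsub>R\<^esub> b c
                        \<zero>\<^bsub>R\<^esub> \<one>\<^bsub>R\<^esub> (\<ominus>\<^bsub>R\<^esub> \<tau> b)
                        \<zero>\<^bsub>R\<^esub> \<zero>\<^bsub>R\<^esub> \<one>\<^bsub>R\<^esub>"

definition L_mat :: "('a, 'm) ring_scheme \<Rightarrow> ('a \<Rightarrow> 'a) \<Rightarrow> 'a \<Rightarrow> 'a \<Rightarrow> 'a ^ 3 ^ 3" where
  "L_mat R \<tau> b c = mat3 \<one>\<^bsub>R\<^esub> \<zero>\<^bsub>R\<^esub> \<zero>\<^bsub>R\<^esub>
                        b \<one>\<^bsub>R\<^esub> \<zero>\<^bsub>R\<^esub>
                        c (\<ominus>\<^bsub>R\<^esub> \<tau> b) \<one>\<^bsub>R\<^esub>"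

text \<open>The condition under which \<open>U_mat\<close> and \<open>L_mat\<close> are unitary: it
  says that the column with entries 1, \<open>b\<close>, \<open>c\<close> is isotropic for the form
  behind \<open>dagger\<close>.\<close>

definition unip_param :: "('a, 'm) ring_scheme \<Rightarrow> ('a \<Rightarrow> 'a) \<Rightarrow> 'a \<Rightarrow> 'a \<Rightarrow> bool" where
  "unip_param R \<tau> b c \<longleftrightarrow> b \<in> carrier R \<and> c \<in> carrier R \<and> c \<oplus>\<^bsub>R\<^esub> \<tau> c \<oplus>\<^bsub>R\<^esub> \<tau> b \<otimes>\<^bsub>R\<^esub> b = \<zero>\<^bsub>R\<^esub>"

locale involutive_cring = cring R for R (structure) +
  fixes \<tau> :: "'a \<Rightarrow> 'a"
  assumes \<tau>_hom: "\<tau> \<in> ring_hom R R"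
    and \<tau>_invol [simp]: "\<And>x. x \<in> carrier R \<Longrightarrow> \<tau> (\<tau> x) = x"
begin

sublocale \<tau>: ring_hom_cring R R \<tau>
  by unfold_locales (rule \<tau>_hom)

lemma \<tau>_Units [simp]:
  assumes "x \<in> Units R"
  shows "\<tau> x \<in> Units R"
proof -
  have "\<tau> x \<otimes> \<tau> (inv x) = \<one>"
    using assms \<tau>.hom_mult[of x "inv x"] Units_closed[of x] by simp
  moreover have "\<tau> x \<in> carrier R" "\<tau> (inv x) \<in> carrier R"
    using assms Units_closed[of x] by simp_all
  ultimately show ?thesis
    unfolding Units_def by (auto simp: m_comm intro!: bexI[of _ "\<tau> (inv x)"])
qed

lemma \<tau>_inv [simp]:
  assumes "x \<in> Units R"
  shows "\<tau> (inv x) = inv (\<tau> x)"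
proof (rule comm_inv_char[symmetric])
  show "\<tau> x \<otimes> \<tau> (inv x) = \<one>"
    using assms \<tau>.hom_mult[of x "inv x"] Units_closed[of x] by simp
qed (use assms in auto)

lemma dagger_mats [simp]:
  assumes "A \<in> mats R"
  shows "dagger \<tau> A \<in> mats R"
proof -
  have "dagger \<tau> A $ i $ j \<in> carrier R" for i j
    using assms by simp
  then show ?thesis
    unfolding mats_def by blast
qed

lemma dagger_dagger [simp]: "A \<in> mats R \<Longrightarrow> dagger \<tau> (dagger \<tau> A) = A"
  by (simp add: mat3_eq_iff)

lemma dagger_one [simp]: "dagger \<tau> (mat_one R) = mat_one R"
  by (simp add: mat3_eq_iff)

lemma dagger_mult:
  assumes "A \<in> mats R" "B \<in> mats R"
  shows "dagger \<tau> (mat_mult R A B) = mat_mult R (dagger \<tau> B) (dagger \<tau> A)"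
  unfolding mat3_eq_iff using assms by (simp add: mat_mult_nth dot3_def m_comm a_ac)

lemma mat_det_dagger:
  assumes "A \<in> mats R"
  shows "mat_det R (dagger \<tau> A) = \<tau> (mat_det R A)"
  using assms by (simp add: mat_det_det3 det3_def m_ac a_ac)

lemma SU3_iff:
  "g \<in> SU3 R \<tau> \<longleftrightarrow> g \<in> mats R \<and> mat_det R g = \<one> \<and> mat_mult R (dagger \<tau> g) g = mat_one R"
  by (auto simp: SU3_def SL3_carrier dagger_def)

lemma SU3_mats [simp]: "g \<in> SU3 R \<tau> \<Longrightarrow> g \<in> mats R"
  by (simp add: SU3_iff)

lemma SU3_SL3 [simp]: "g \<in> SU3 R \<tau> \<Longrightarrow> g \<in> carrier (SL3 R)"
  by (simp add: SU3_iff SL3_carrier)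

lemma dagger_SL3: "g \<in> SU3 R \<tau> \<Longrightarrow> dagger \<tau> g \<in> carrier (SL3 R)"
  by (simp add: SU3_iff SL3_carrier mat_det_dagger)

lemma inv_SU3:
  assumes "g \<in> SU3 R \<tau>"
  shows "inv\<^bsub>SL3 R\<^esub> g = dagger \<tau> g"
proof -
  interpret group "SL3 R"
    by (rule SL3_group)
  show ?thesis
    using assms dagger_SL3[OF assms] by (intro inv_equality) (simp_all add: SU3_iff)
qed

lemma SU3_right:
  assumes "g \<in> SU3 R \<tau>"
  shows "mat_mult R g (dagger \<tau> g) = mat_one R"
proof -
  interpret group "SL3 R"
    by (rule SL3_group)
  show ?thesis
    using r_inv[of g] assms by (simp add: inv_SU3)
qed

lemma SU3_dagger [simp]: "g \<in> SU3 R \<tau> \<Longrightarrow> dagger \<tau> g \<in> SU3 R \<tau>"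
  using SU3_right[of g] by (simp add: SU3_iff mat_det_dagger)

lemma SU3_one [simp]: "mat_one R \<in> SU3 R \<tau>"
  by (simp add: SU3_iff)

lemma SU3_mult [simp]:
  assumes "g \<in> SU3 R \<tau>" "h \<in> SU3 R \<tau>"
  shows "mat_mult R g h \<in> SU3 R \<tau>"
proof -
  have "mat_mult R (dagger \<tau> (mat_mult R g h)) (mat_mult R g h) =
      mat_mult R (dagger \<tau> h) (mat_mult R (mat_mult R (dagger \<tau> g) g) h)"
    using assms by (simp add: dagger_mult mat_mult_assoc)
  also have "\<dots> = mat_one R"
    using assms by (simp add: SU3_iff)
  finally show ?thesis
    using assms by (simp add: SU3_iff mat_det_mult)
qed

lemma SU3_cancel [simp]:
  assumes "g \<in> SU3 R \<tau>" "h \<in> mats R"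
  shows "mat_mult R g (mat_mult R (dagger \<tau> g) h) = h" "mat_mult R (dagger \<tau> g) (mat_mult R g h) = h"
  using assms SU3_right[of g] by (simp_all flip: mat_mult_assoc) (simp add: SU3_iff)

lemma mats_mat3:
  "mat3 a b c d e f g h k \<in> mats R \<longleftrightarrow> {a, b, c, d, e, f, g, h, k} \<subseteq> carrier R"
  unfolding mats_def by (auto simp: forall_3)

lemma T_mat_SU3:
  assumes "x \<in> Units R"
  shows "T_mat R \<tau> x \<in> SU3 R \<tau>"
proof -
  have x: "x \<in> carrier R" "inv x \<in> carrier R" "\<tau> x \<in> carrier R" "inv (\<tau> x) \<in> carrier R"
    "x \<otimes> inv x = \<one>" "\<tau> x \<otimes> inv (\<tau> x) = \<one>" "inv x \<otimes> x = \<one>" "inv (\<tau> x) \<otimes> \<tau> x = \<one>"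
    using assms by auto
  have T: "T_mat R \<tau> x \<in> mats R"
    using x by (simp add: T_mat_def mats_mat3)
  have e: "x \<otimes> (inv x \<otimes> \<tau> x) \<otimes> inv (\<tau> x) = \<one>"
    using x by (metis l_one m_assoc m_closed)
  have e2: "inv (\<tau> x) \<otimes> x \<otimes> (inv x \<otimes> \<tau> x) = \<one>"
    using x e by (metis m_assoc m_closed m_comm)
  have "mat_det R (T_mat R \<tau> x) = \<one>"
    unfolding mat_det_det3[OF T] using x e by (simp add: det3_def T_mat_def minus_eq)
  \<comment> \<open>The product is expanded while \<open>T_mat\<close> is folded, so that
    \<open>T\<close> discharges the carrier conditions; the entries are inserted afterwards.\<close>
  moreover have "mat_mult R (dagger \<tau> (T_mat R \<tau> x)) (T_mat R \<tau> x) = mat_one R"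
    unfolding mat3_eq_iff forall_3
    using T x assms e2 by (simp add: mat_mult_nth dot3_def) (simp add: T_mat_def)
  ultimately show ?thesis
    using T by (simp add: SU3_iff)
qed

lemma M_mat_SU3:
  assumes "x \<in> Units R"
  shows "M_mat R \<tau> x \<in> SU3 R \<tau>"
proof -
  have x: "x \<in> carrier R" "inv x \<in> carrier R" "\<tau> x \<in> carrier R" "inv (\<tau> x) \<in> carrier R"
    "x \<otimes> inv x = \<one>" "\<tau> x \<otimes> inv (\<tau> x) = \<one>" "inv x \<otimes> x = \<one>" "inv (\<tau> x) \<otimes> \<tau> x = \<one>"
    using assms by auto
  have T: "M_mat R \<tau> x \<in> mats R"
    using x by (simp add: M_mat_def mats_mat3)
  have e: "x \<otimes> (inv x \<otimes> \<tau> x) \<otimes> inv (\<tau> x) = \<one>"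
    using x by (metis l_one m_assoc m_closed)
  have e2: "inv (\<tau> x) \<otimes> x \<otimes> (inv x \<otimes> \<tau> x) = \<one>"
    using x e by (metis m_assoc m_closed m_comm)
  have "mat_det R (M_mat R \<tau> x) = \<one>"
    unfolding mat_det_det3[OF T] using x e by (simp add: det3_def M_mat_def minus_eq l_minus r_minus)
  moreover have "mat_mult R (dagger \<tau> (M_mat R \<tau> x)) (M_mat R \<tau> x) = mat_one R"
    unfolding mat3_eq_iff forall_3
    using T x assms e2 by (simp add: mat_mult_nth dot3_def) (simp add: M_mat_def l_minus r_minus)
  ultimately show ?thesis
    using T by (simp add: SU3_iff)
qed

lemma U_mat_SU3:
  assumes "unip_param R \<tau> b c"
  shows "U_mat R \<tau> b c \<in> SU3 R \<tau>"
proof -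
  have x: "b \<in> carrier R" "c \<in> carrier R" "\<tau> b \<in> carrier R" "\<tau> c \<in> carrier R"
    "c \<oplus> \<tau> c \<oplus> \<tau> b \<otimes> b = \<zero>"
    using assms by (auto simp: unip_param_def)
  have T: "U_mat R \<tau> b c \<in> mats R"
    using x by (simp add: U_mat_def mats_mat3)
  have "mat_det R (U_mat R \<tau> b c) = \<one>"
    unfolding mat_det_det3[OF T] using x by (simp add: det3_def U_mat_def minus_eq)
  moreover have "c \<oplus> \<ominus> b \<otimes> \<ominus> \<tau> b \<oplus> \<tau> c = \<zero>"
    using x(1-4) unfolding x(5)[symmetric] by algebra
  then have "mat_mult R (dagger \<tau> (U_mat R \<tau> b c)) (U_mat R \<tau> b c) = mat_one R"
    unfolding mat3_eq_iff forall_3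
    using T x by (simp add: mat_mult_nth dot3_def) (simp add: U_mat_def r_neg l_neg)
  ultimately show ?thesis
    using T by (simp add: SU3_iff)
qed

lemma L_mat_SU3:
  assumes "unip_param R \<tau> b c"
  shows "L_mat R \<tau> b c \<in> SU3 R \<tau>"
proof -
  have x: "b \<in> carrier R" "c \<in> carrier R" "\<tau> b \<in> carrier R" "\<tau> c \<in> carrier R"
    "c \<oplus> \<tau> c \<oplus> \<tau> b \<otimes> b = \<zero>"
    using assms by (auto simp: unip_param_def)
  have T: "L_mat R \<tau> b c \<in> mats R"
    using x by (simp add: L_mat_def mats_mat3)
  have "mat_det R (L_mat R \<tau> b c) = \<one>"
    unfolding mat_det_det3[OF T] using x by (simp add: det3_def L_mat_def minus_eq)
  moreover have "\<tau> c \<oplus> \<tau> b \<otimes> b \<oplus> c = \<zero>"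
    using x(1-4) unfolding x(5)[symmetric] by algebra
  then have "mat_mult R (dagger \<tau> (L_mat R \<tau> b c)) (L_mat R \<tau> b c) = mat_one R"
    unfolding mat3_eq_iff forall_3
    using T x by (simp add: mat_mult_nth dot3_def) (simp add: L_mat_def r_neg l_neg)
  ultimately show ?thesis
    using T by (simp add: SU3_iff)
qed

text \<open>Unitarity read as orthogonality relations between the columns; for i = j = 1 the first
  column is isotropic.\<close>

lemma SU3_column_relation:
  assumes "g \<in> SU3 R \<tau>"
  shows "\<tau> (g $ 3 $ i) \<otimes> g $ 1 $ j \<oplus> \<tau> (g $ 2 $ i) \<otimes> g $ 2 $ j \<oplus> \<tau> (g $ 1 $ i) \<otimes> g $ 3 $ j =
    (if i = 4 - j then \<one> else \<zero>)"
proof -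
  have "mat_mult R (dagger \<tau> g) g $ (4 - i) $ j = (if 4 - i = j then \<one> else \<zero>)"
    using assms by (simp add: SU3_iff)
  moreover have "4 - i = j \<longleftrightarrow> i = 4 - j"
    by auto
  ultimately show ?thesis
    using assms by (simp add: mat_mult_nth dot3_def)
qed

text \<open>Pairing the first column with columns 2 and 3 gives the bottom row, the determinant
  gives the entry (2,2), and the pairings of columns 2 and 3 with column 3 give the rest.\<close>

lemma SU3_unipotent:
  assumes k: "k \<in> SU3 R \<tau>" and "k $ 1 $ 1 = \<one>" "k $ 2 $ 1 = \<zero>" "k $ 3 $ 1 = \<zero>"
  shows "unip_param R \<tau> (k $ 1 $ 2) (k $ 1 $ 3)" "k = U_mat R \<tau> (k $ 1 $ 2) (k $ 1 $ 3)"
proof -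
  have m: "k $ i $ j \<in> carrier R" for i j
    using k by simp
  note [simp] = assms(2-)
  have k3: "k $ 3 $ 2 = \<zero>" "k $ 3 $ 3 = \<one>"
    using SU3_column_relation[OF k, of 1 2] SU3_column_relation[OF k, of 1 3] m by simp_all
  have "mat_det R k = k $ 2 $ 2"
    using m k by (simp add: mat_det_det3 det3_def k3 minus_eq)
  then have k22: "k $ 2 $ 2 = \<one>"
    using k by (simp add: SU3_iff)
  have "k $ 2 $ 3 \<oplus> \<tau> (k $ 1 $ 2) = \<zero>"
    using SU3_column_relation[OF k, of 2 3] m by (simp add: k3 k22)
  then have k23: "k $ 2 $ 3 = \<ominus> \<tau> (k $ 1 $ 2)"
    using m by (simp add: minus_equality)
  have "k $ 1 $ 3 \<oplus> k $ 1 $ 2 \<otimes> \<tau> (k $ 1 $ 2) \<oplus> \<tau> (k $ 1 $ 3) = \<zero>"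
    using SU3_column_relation[OF k, of 3 3] m by (simp add: k3 k23 l_minus r_minus)
  then show "unip_param R \<tau> (k $ 1 $ 2) (k $ 1 $ 3)"
    using m by (simp add: unip_param_def m_comm a_ac)
  show "k = U_mat R \<tau> (k $ 1 $ 2) (k $ 1 $ 3)"
    by (simp add: mat3_eq_iff forall_3 U_mat_def k3 k22 k23)
qed

text \<open>Gaussian elimination inside the unitary group: a lower unipotent matrix whose first
  column is proportional to that of \<open>g\<close> is divided off, then the diagonal matrix with
  the same corner, and what remains fixes the first basis vector.\<close>

lemma SU3_decomposition:
  assumes g: "g \<in> SU3 R \<tau>" and a: "g $ 1 $ 1 \<in> Units R"
  obtains b c b' c' where "unip_param R \<tau> b c" "unip_param R \<tau> b' c'"
    "g = mat_mult R (L_mat R \<tau> b c) (mat_mult R (T_mat R \<tau> (g $ 1 $ 1)) (U_mat R \<tau> b' c'))"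
proof -
  define a where "a = g $ 1 $ 1"
  define b where "b = g $ 2 $ 1 \<otimes> inv a"
  define c where "c = g $ 3 $ 1 \<otimes> inv a"
  have aU: "a \<in> Units R"
    using a by (simp add: a_def)
  have car: "a \<in> carrier R" "inv a \<in> carrier R" "\<tau> a \<in> carrier R" "inv (\<tau> a) \<in> carrier R"
      "b \<in> carrier R" "c \<in> carrier R" "\<tau> b \<in> carrier R" "\<tau> c \<in> carrier R"
    using g aU by (auto simp: b_def c_def)
  have g21: "g $ 2 $ 1 = b \<otimes> a" and g31: "g $ 3 $ 1 = c \<otimes> a"
    using g aU car unfolding b_def c_def by (simp_all add: m_assoc)
  \<comment> \<open>Isotropy of the first column of \<open>g\<close>, whose entries are
    \<open>a\<close>, \<open>b \<otimes> a\<close> and \<open>c \<otimes> a\<close>, is the relation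
    for \<open>b\<close> and \<open>c\<close> multiplied by the unit
    \<open>\<tau> a \<otimes> a\<close>.\<close>
  have "(c \<oplus> \<tau> c \<oplus> \<tau> b \<otimes> b) \<otimes> (\<tau> a \<otimes> a) = \<tau> (c \<otimes> a) \<otimes> a \<oplus> \<tau> (b \<otimes> a) \<otimes> (b \<otimes> a) \<oplus> \<tau> a \<otimes> (c \<otimes> a)"
    using car by (simp add: l_distr r_distr m_ac a_ac)
  also have "\<dots> = \<zero>"
    using SU3_column_relation[OF g, of 1 1] by (simp add: g21 g31 flip: a_def)
  finally have "(c \<oplus> \<tau> c \<oplus> \<tau> b \<otimes> b) \<otimes> (\<tau> a \<otimes> a) = \<zero> \<otimes> (\<tau> a \<otimes> a)"
    using car by simp
  moreover have "\<tau> a \<otimes> a \<in> Units R"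
    using aU by simp
  ultimately have rel: "c \<oplus> \<tau> c \<oplus> \<tau> b \<otimes> b = \<zero>"
    using car by (metis Units_l_cancel a_closed m_closed m_comm zero_closed)
  then have par: "unip_param R \<tau> b c"
    using car by (simp add: unip_param_def)
  define l where "l = L_mat R \<tau> b c"
  have l: "l \<in> SU3 R \<tau>"
    using L_mat_SU3[OF par] by (simp add: l_def)
  define h where "h = mat_mult R (dagger \<tau> l) g"
  have h: "h \<in> SU3 R \<tau>"
    using l g by (simp add: h_def)
  have h_nth: "h $ i $ 1 = dot3 R (dagger \<tau> l $ i $ 1) (dagger \<tau> l $ i $ 2) (dagger \<tau> l $ i $ 3) a (b \<otimes> a) (c \<otimes> a)" for i
    using l g unfolding h_def by (subst mat_mult_nth) (simp_all add: g21 g31 a_def)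
  have h1: "h $ 1 $ 1 = a"
    using car by (simp add: h_nth dot3_def l_def L_mat_def)
  have h2: "h $ 2 $ 1 = \<zero>"
    using car by (simp add: h_nth dot3_def l_def L_mat_def l_minus l_neg)
  \<comment> \<open>The parameter relation reappears as the factor that kills this entry.\<close>
  have "h $ 3 $ 1 = (c \<oplus> \<tau> c \<oplus> \<tau> b \<otimes> b) \<otimes> a"
    using car by (simp add: h_nth dot3_def l_def L_mat_def l_distr m_assoc a_ac)
  then have h3: "h $ 3 $ 1 = \<zero>"
    using car by (simp add: rel)
  define t where "t = T_mat R \<tau> a"
  have t: "t \<in> SU3 R \<tau>"
    using T_mat_SU3[OF aU] by (simp add: t_def)
  define k where "k = mat_mult R (dagger \<tau> t) h"
  have k: "k \<in> SU3 R \<tau>"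
    using t h by (simp add: k_def)
  have k_nth: "k $ i $ 1 = dot3 R (dagger \<tau> t $ i $ 1) (dagger \<tau> t $ i $ 2) (dagger \<tau> t $ i $ 3) a \<zero> \<zero>" for i
    using t h unfolding k_def by (subst mat_mult_nth) (simp_all add: h1 h2 h3)
  have "k $ 1 $ 1 = \<one>" "k $ 2 $ 1 = \<zero>" "k $ 3 $ 1 = \<zero>"
    using car aU by (simp_all add: k_nth dot3_def t_def T_mat_def)
  note k' = SU3_unipotent[OF k this]
  have "g = mat_mult R l (mat_mult R t k)"
    using l t h g by (simp add: k_def h_def)
  with par k' show thesis
    by (auto simp: l_def t_def a_def intro: that)
qed

end


section \<open>Valuations and the conjugation\<close>

context valued_field
begin

lemma v_one [simp]: "v \<one> = 0"
  using v_mult[of \<one> \<one>] v_finite[of \<one>] by (cases "v \<one>") auto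

lemma v_not_MInf [simp]: "x \<in> carrier F \<Longrightarrow> v x \<noteq> -\<infinity>"
  using v_finite[of x] v_zero by fastforce

lemma v_real: "x \<in> carrier F \<Longrightarrow> x \<noteq> \<zero> \<Longrightarrow> ereal (real_of_ereal (v x)) = v x"
  using v_finite[of x] by (simp add: ereal_real)

lemma v_uminus [simp]:
  assumes "x \<in> carrier F"
  shows "v (\<ominus> x) = v x"
proof -
  have "v (\<ominus> \<one>) + v (\<ominus> \<one>) = 0"
    using v_mult[of "\<ominus> \<one>" "\<ominus> \<one>"] by (simp add: l_minus)
  then have "v (\<ominus> \<one>) = 0"
    by (cases "v (\<ominus> \<one>)") auto
  then show ?thesis
    using v_mult[of "\<ominus> \<one>" x] assms by (simp add: l_minus)
qed

lemma nonzero_Units: "x \<in> carrier F \<Longrightarrow> x \<noteq> \<zero> \<Longrightarrow> x \<in> Units F"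
  by (simp add: field_Units)

lemma inv_nonzero [simp]:
  assumes "x \<in> carrier F" "x \<noteq> \<zero>"
  shows "inv x \<in> carrier F" "inv x \<noteq> \<zero>" "x \<otimes> inv x = \<one>" "inv x \<otimes> x = \<one>"
  using nonzero_Units[OF assms] Units_inv_Units[of x] by (auto simp: field_Units)

lemma v_inv:
  assumes "x \<in> carrier F" "x \<noteq> \<zero>"
  shows "v (inv x) = - v x"
proof -
  have "v x + v (inv x) = 0"
    using v_mult[of x "inv x"] assms by simp
  then show ?thesis
    by (cases "v x"; cases "v (inv x)") auto
qed

lemma v_add_ge: "x \<in> carrier F \<Longrightarrow> y \<in> carrier F \<Longrightarrow> c \<le> v x \<Longrightarrow> c \<le> v y \<Longrightarrow> c \<le> v (x \<oplus> y)"
  using v_add[of x y] by (meson min.boundedI order_trans)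

lemma v_minus_ge: "x \<in> carrier F \<Longrightarrow> y \<in> carrier F \<Longrightarrow> c \<le> v x \<Longrightarrow> c \<le> v y \<Longrightarrow> c \<le> v (x \<ominus> y)"
  by (simp add: minus_eq v_add_ge)

lemma v_add_gr: "x \<in> carrier F \<Longrightarrow> y \<in> carrier F \<Longrightarrow> c < v x \<Longrightarrow> c < v y \<Longrightarrow> c < v (x \<oplus> y)"
  using v_add[of x y] by (meson min_less_iff_conj order_less_le_trans)

lemma v_mult_ge: "x \<in> carrier F \<Longrightarrow> y \<in> carrier F \<Longrightarrow> a \<le> v x \<Longrightarrow> b \<le> v y \<Longrightarrow> a + b \<le> v (x \<otimes> y)"
  by (simp add: v_mult add_mono)

lemma v_add_eq:
  assumes "x \<in> carrier F" "y \<in> carrier F" "v x < v y"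
  shows "v (x \<oplus> y) = v x"
proof (rule antisym)
  have "min (v (x \<oplus> y)) (v y) \<le> v x"
    using v_add[of "x \<oplus> y" "\<ominus> y"] assms by (simp add: a_assoc r_neg)
  then show "v (x \<oplus> y) \<le> v x"
    using assms by (auto simp: min_def split: if_splits)
  show "v x \<le> v (x \<oplus> y)"
    using assms by (simp add: v_add_ge)
qed

lemma val_ring_carrier [simp]: "x \<in> carrier (val_ring F v) \<longleftrightarrow> x \<in> carrier F \<and> 0 \<le> v x"
  by (simp add: val_ring_def)

lemma val_ring_simps [simp]:
  "x \<otimes>\<^bsub>val_ring F v\<^esub> y = x \<otimes> y" "x \<oplus>\<^bsub>val_ring F v\<^esub> y = x \<oplus> y"
  "\<one>\<^bsub>val_ring F v\<^esub> = \<one>" "\<zero>\<^bsub>val_ring F v\<^esub> = \<zero>"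
  by (simp_all add: val_ring_def)

lemma subcring_val_ring: "subcring {x \<in> carrier F. 0 \<le> v x} F"
proof (rule subcringI')
  show "subring {x \<in> carrier F. 0 \<le> v x} F"
  proof (rule ring.subringI[OF ring_axioms])
    fix x y assume "x \<in> {x \<in> carrier F. 0 \<le> v x}" "y \<in> {x \<in> carrier F. 0 \<le> v x}"
    then show "x \<otimes> y \<in> {x \<in> carrier F. 0 \<le> v x}" "x \<oplus> y \<in> {x \<in> carrier F. 0 \<le> v x}"
      using v_mult_ge[of x y 0 0] by (auto simp: v_add_ge)
  qed auto
qed

lemma val_ring_cring: "cring (val_ring F v)"
  unfolding val_ring_def using subcring_val_ring
  by (subst (asm) subcring_iff) auto

lemma val_ring_uminus [simp]:
  assumes "x \<in> carrier F" "0 \<le> v x"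
  shows "\<ominus>\<^bsub>val_ring F v\<^esub> x = \<ominus> x"
proof -
  interpret O: cring "val_ring F v"
    by (rule val_ring_cring)
  show ?thesis
    using assms O.minus_equality[of "\<ominus> x" x] by (simp add: l_neg)
qed

lemma val_ring_minus [simp]:
  "x \<in> carrier F \<Longrightarrow> y \<in> carrier F \<Longrightarrow> 0 \<le> v y \<Longrightarrow> x \<ominus>\<^bsub>val_ring F v\<^esub> y = x \<ominus> y"
  by (simp add: a_minus_def)

lemma val_ring_ideal:
  assumes "\<And>x y. x \<in> J \<Longrightarrow> y \<in> J \<Longrightarrow> x \<oplus> y \<in> J" "\<And>x y. x \<in> J \<Longrightarrow> y \<in> carrier F \<Longrightarrow> 0 \<le> v y \<Longrightarrow> y \<otimes> x \<in> J"
    "J \<subseteq> carrier (val_ring F v)" "\<zero> \<in> J"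
  shows "ideal J (val_ring F v)"
proof -
  interpret O: cring "val_ring F v"
    by (rule val_ring_cring)
  have J: "x \<in> carrier F" "0 \<le> v x" if "x \<in> J" for x
    using assms(3) that by auto
  show ?thesis
  proof (rule idealI[OF O.ring_axioms])
    show "subgroup J (add_monoid (val_ring F v))"
    proof (rule O.add.subgroupI)
      fix x assume x: "x \<in> J"
      then have "\<ominus> \<one> \<otimes> x \<in> J"
        by (intro assms(2)) auto
      then show "\<ominus>\<^bsub>val_ring F v\<^esub> x \<in> J"
        using J[OF x] by (simp add: l_minus)
    qed (use assms in auto)
    fix a x assume a: "a \<in> J" "x \<in> carrier (val_ring F v)"
    then show "x \<otimes>\<^bsub>val_ring F v\<^esub> a \<in> J" "a \<otimes>\<^bsub>val_ring F v\<^esub> x \<in> J"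
      using assms(2)[of a x] J[OF a(1)] by (auto simp: m_comm)
  qed
qed

lemma val_ideal_ideal: "ideal (val_ideal F v) (val_ring F v)"
proof (rule val_ring_ideal)
  fix x y assume "x \<in> val_ideal F v" "y \<in> carrier F" "0 \<le> v y"
  then show "y \<otimes> x \<in> val_ideal F v"
    by (auto simp: val_ideal_def v_mult intro: add_nonneg_pos)
qed (auto simp: val_ideal_def v_zero v_add_gr less_imp_le)

lemma val_ge_ideal:
  assumes "0 \<le> c"
  shows "ideal {x \<in> carrier F. c \<le> v x} (val_ring F v)"
proof (rule val_ring_ideal)
  fix x y assume "x \<in> {x \<in> carrier F. c \<le> v x}" "y \<in> carrier F" "0 \<le> v y"
  then show "y \<otimes> x \<in> {x \<in> carrier F. c \<le> v x}"
    using v_mult_ge[of y x 0 c] by simp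
qed (use assms in \<open>auto simp: v_zero v_add_ge\<close>)

text \<open>Used for \<open>K\<close> in contrapositive form: odd residue characteristic means that
  2 is a unit of the valuation ring.\<close>

lemma residue_two:
  assumes "0 < v (\<one> \<oplus> \<one>)"
  shows "\<one>\<^bsub>residue_field F v\<^esub> \<oplus>\<^bsub>residue_field F v\<^esub> \<one>\<^bsub>residue_field F v\<^esub> = \<zero>\<^bsub>residue_field F v\<^esub>"
proof -
  interpret I: ideal "val_ideal F v" "val_ring F v"
    by (rule val_ideal_ideal)
  interpret h: ring_hom_ring "val_ring F v" "residue_field F v" "(+>\<^bsub>val_ring F v\<^esub>) (val_ideal F v)"
    unfolding residue_field_def by (rule I.rcos_ring_hom_ring)
  have "val_ideal F v +>\<^bsub>val_ring F v\<^esub> (\<one> \<oplus> \<one>) = val_ideal F v"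
    using assms by (intro I.a_rcos_const) (simp add: val_ideal_def)
  then show ?thesis
    using h.hom_add[of \<one> \<one>] h.hom_one by (simp add: residue_field_def FactRing_def)
qed

end

section \<open>Invariance of the valuation under the conjugation\<close>

context ramified_quadratic_extension
begin

sublocale KV: local_field "F\<lparr>carrier := K\<rparr>" v
  by (rule local_field)

lemma K_subset: "K \<subseteq> carrier F"
  using subfieldE(3)[OF subfield] .

lemma v_two: "v (\<one> \<oplus> \<one>) = 0"
proof -
  have "0 \<le> v (\<one> \<oplus> \<one>)"
    by (simp add: v_add_ge)
  moreover have "\<not> 0 < v (\<one> \<oplus> \<one>)"
    using odd_residue_char KV.residue_two by (auto simp: Let_def)
  ultimately show ?thesis
    by simp
qed

text \<open>Discreteness over \<open>K\<close> excludes the trivial valuation; this will keep a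
  uniformiser from being zero.\<close>

lemma exists_positive: "\<exists>x\<in>carrier F. x \<noteq> \<zero> \<and> 0 < v x"
proof -
  obtain c :: real where c: "0 < c" "v ` (K - {\<zero>}) = range (\<lambda>n::int. ereal (c * real_of_int n))"
    using KV.discrete by auto
  have "ereal (c * real_of_int 1) \<in> v ` (K - {\<zero>})"
    unfolding c(2) by blast
  then obtain x where x: "x \<in> K - {\<zero>}" "ereal (c * real_of_int 1) = v x"
    by (rule imageE)
  then have "v x = ereal c"
    by simp
  then show ?thesis
    using K_subset c(1) x(1) by (intro bexI[of _ x]) auto
qed

lemma sigma_hom: "\<sigma> \<in> ring_hom F F"
  using conj_iso by (simp add: ring_iso_def)

sublocale sigma: ring_hom_cring F F \<sigma>
  by unfold_locales (rule sigma_hom)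

lemma K_closed:
  assumes "a \<in> K" "b \<in> K"
  shows "a \<oplus> b \<in> K" "a \<otimes> b \<in> K" "\<ominus> a \<in> K" "b \<noteq> \<zero> \<Longrightarrow> inv b \<in> K"
  using subringE(5,6,7)[OF subfieldE(1)[OF subfield]] subfield_m_inv(1)[OF subfield, of b] assms by auto

text \<open>By ramification such elements exist; together with 1 each of them is a basis over
  \<open>K\<close> adapted to the valuation.\<close>

definition off_K :: "'a \<Rightarrow> bool" where
  "off_K x \<longleftrightarrow> x \<in> carrier F \<and> x \<noteq> \<zero> \<and> v x \<notin> v ` (K - {\<zero>})"

text \<open>The two summands never have equal finite valuation, as otherwise \<open>v x\<close>
  would be the valuation of \<open>inv b \<otimes> a\<close> in \<open>K\<close>; so the ultrametric
  inequality is sharp.\<close>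

lemma v_combination:
  assumes x: "off_K x" and "a \<in> K" "b \<in> K"
  shows "v (b \<otimes> x \<oplus> a) = min (v b + v x) (v a)"
proof -
  have car: "x \<in> carrier F" "a \<in> carrier F" "b \<in> carrier F" "x \<noteq> \<zero>"
    using assms K_subset by (auto simp: off_K_def)
  have ne: "v b + v x \<noteq> v a" if nz: "b \<noteq> \<zero>" "a \<noteq> \<zero>"
  proof
    assume eq: "v b + v x = v a"
    have "v (inv b \<otimes> a) = - v b + v a"
      using car nz by (simp add: v_mult v_inv)
    also have "\<dots> = v x"
      unfolding eq[symmetric] using v_finite[of b] v_finite[of x] car nz
      by (cases "v b"; cases "v x") auto
    finally have "v x \<in> v ` (K - {\<zero>})"
      using K_closed assms car nz by (intro image_eqI[of _ _ "inv b \<otimes> a"]) (auto simp: integral_iff)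
    then show False
      using x by (simp add: off_K_def)
  qed
  consider "b = \<zero>" | "a = \<zero>" | "b \<noteq> \<zero>" "a \<noteq> \<zero>" "v (b \<otimes> x) < v a" | "b \<noteq> \<zero>" "a \<noteq> \<zero>" "v a < v (b \<otimes> x)"
    using ne car by (metis v_mult linorder_neq_iff)
  then show ?thesis
  proof cases
    case 3
    then show ?thesis
      using v_add_eq[of "b \<otimes> x" a] car by (auto simp: v_mult min_def)
  next
    case 4
    then show ?thesis
      using v_add_eq[of a "b \<otimes> x"] car by (auto simp: v_mult a_comm min_def)
  qed (use car in \<open>auto simp: v_zero v_mult\<close>)
qed

text \<open>An element off \<open>K\<close> is not in \<open>K\<close>, so with 1 it makes an
  independent list whose length is the dimension 2.\<close>

lemma off_K_basis:
  assumes x: "off_K x" and y: "y \<in> carrier F"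
  obtains a b where "a \<in> K" "b \<in> K" "y = b \<otimes> x \<oplus> a"
proof -
  have car: "x \<in> carrier F"
    using x by (simp add: off_K_def)
  have span1: "Span K [\<one>] = K"
    using K_subset subringE(2)[OF subfieldE(1)[OF subfield]] by (force simp: line_extension_mem_iff)
  have "x \<notin> K"
    using x by (auto simp: off_K_def)
  then have "independent K [x, \<one>]"
    using car by (intro li_Cons) (auto simp: span1 simp del: Span.simps, auto)
  then have "Span K [x, \<one>] = carrier F"
    using independent_length_eq_dimension[OF subfield quadratic, of "[x, \<one>]"] car by auto
  moreover have "Span K [x, \<one>] = line_extension K x K"
    using span1 by simp
  ultimately show thesis
    using y that by (auto simp: line_extension_mem_iff)
qed

lemma off_K_exists: "\<exists>x. off_K x"
  using ramified K_subset unfolding off_K_def by blast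

lemma off_K_sigma:
  assumes x: "off_K x"
  shows "\<sigma> (\<sigma> x) = x" "v (\<sigma> x) = v x"
proof -
  have xF: "x \<in> carrier F" "x \<noteq> \<zero>"
    using x by (auto simp: off_K_def)
  \<comment> \<open>\<open>x\<close> is a root of X^2 - b X - a, so \<open>b\<close> will be its
    trace and \<open>\<ominus> a\<close> its norm.\<close>
  obtain a b where ab: "a \<in> K" "b \<in> K" and sq: "x \<otimes> x = b \<otimes> x \<oplus> a"
    using off_K_basis[OF x, of "x \<otimes> x"] xF by auto
  have car: "a \<in> carrier F" "b \<in> carrier F" "\<sigma> x \<in> carrier F"
    using ab xF K_subset by auto
  have sq': "\<sigma> x \<otimes> \<sigma> x = b \<otimes> \<sigma> x \<oplus> a"
    using arg_cong[OF sq, of \<sigma>] car xF ab by (simp add: conj_fixes)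
  \<comment> \<open>Otherwise \<open>\<sigma>\<close> would fix a basis over \<open>K\<close>, hence
    everything.\<close>
  have ne: "\<sigma> x \<noteq> x"
  proof
    assume fixed: "\<sigma> x = x"
    have "\<sigma> y = y" if "y \<in> carrier F" for y
    proof -
      obtain c d where cd: "c \<in> K" "d \<in> K" "y = d \<otimes> x \<oplus> c"
        using off_K_basis[OF x \<open>y \<in> carrier F\<close>] .
      then have "c \<in> carrier F" "d \<in> carrier F"
        using K_subset by auto
      then show ?thesis
        using cd xF fixed by (simp add: conj_fixes)
    qed
    then show False
      using conj_nontrivial by blast
  qed
  \<comment> \<open>The difference of the two quadratic equations factors. The first factor is
    nonzero by \<open>ne\<close>, and the second identifies \<open>b\<close> as the trace.\<close>
  have "(\<sigma> x \<ominus> x) \<otimes> (\<sigma> x \<oplus> x \<ominus> b) = (\<sigma> x \<otimes> \<sigma> x \<ominus> b \<otimes> \<sigma> x) \<ominus> (x \<otimes> x \<ominus> b \<otimes> x)"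
    using xF(1) car(2,3) by algebra
  also have "\<dots> = \<zero>"
    unfolding sq sq' using xF(1) car by algebra
  finally have "\<sigma> x \<ominus> x = \<zero> \<or> \<sigma> x \<oplus> x \<ominus> b = \<zero>"
    using xF car by (simp add: integral_iff)
  then have "\<sigma> x \<oplus> x \<ominus> b = \<zero>"
    using ne xF car by (simp add: r_right_minus_eq)
  then have "\<sigma> x \<oplus> x = b"
    using xF car by (simp add: r_right_minus_eq)
  moreover have "\<sigma> x = \<ominus> \<one> \<otimes> x \<oplus> (\<sigma> x \<oplus> x)"
    using xF(1) car(3) by algebra
  ultimately have sig: "\<sigma> x = \<ominus> \<one> \<otimes> x \<oplus> b"
    by simp
  have "\<sigma> (\<sigma> x) = \<ominus> \<sigma> x \<oplus> b"
    using arg_cong[OF sig, of \<sigma>] xF car ab by (simp add: conj_fixes l_minus)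
  also have "\<dots> = x"
    unfolding sig using xF(1) car(1,2) by algebra
  finally show "\<sigma> (\<sigma> x) = x" .
  have min: "v (\<sigma> x) = min (v x) (v b)"
    unfolding sig using v_combination[OF x, of b "\<ominus> \<one>"] ab K_closed subringE(3)[OF subfieldE(1)[OF subfield]] by auto
  \<comment> \<open>If not, the minimum is attained by \<open>b\<close> alone; then the norm
    relation \<open>v x + v b = v a\<close> makes \<open>v x\<close> the valuation of an element of
    \<open>K\<close>.\<close>
  show "v (\<sigma> x) = v x"
  proof (rule ccontr)
    assume "v (\<sigma> x) \<noteq> v x"
    then have vb: "v (\<sigma> x) = v b" "v b < v x"
      using min by (auto simp: min_def split: if_splits)
    have b0: "b \<noteq> \<zero>"
      using vb(2) v_zero by auto
    have "x \<otimes> \<sigma> x = b \<otimes> x \<ominus> x \<otimes> x"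
      unfolding sig using xF(1) car(2) by algebra
    also have "\<dots> = \<ominus> a"
      unfolding sq using xF(1) car(1,2) by algebra
    finally have "v x + v b = v a"
      using v_mult[of x "\<sigma> x"] xF car vb by simp
    moreover have a0: "a \<noteq> \<zero>"
      using calculation v_finite[of x] v_finite[of b] xF car b0 by (auto simp: v_zero)
    ultimately have "v (inv b \<otimes> a) = v x"
      using xF car b0 v_finite[of x] v_finite[of b]
      by (cases "v x"; cases "v b"; cases "v a") (auto simp: v_mult v_inv)
    then have "v x \<in> v ` (K - {\<zero>})"
      using K_closed ab car b0 a0 by (intro image_eqI[of _ _ "inv b \<otimes> a"]) (auto simp: integral_iff)
    then show False
      using x by (simp add: off_K_def)
  qed
qed

lemma sigma_invol:
  assumes "y \<in> carrier F"
  shows "\<sigma> (\<sigma> y) = y"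
proof -
  obtain x where x: "off_K x"
    using off_K_exists by blast
  obtain a b where ab: "a \<in> K" "b \<in> K" "y = b \<otimes> x \<oplus> a"
    using off_K_basis[OF x assms] .
  then have "a \<in> carrier F" "b \<in> carrier F" "x \<in> carrier F"
    using K_subset x by (auto simp: off_K_def)
  then show ?thesis
    using ab off_K_sigma[OF x] by (simp add: conj_fixes)
qed

lemma v_sigma [simp]:
  assumes "y \<in> carrier F"
  shows "v (\<sigma> y) = v y"
proof -
  obtain x where x: "off_K x"
    using off_K_exists by blast
  obtain a b where ab: "a \<in> K" "b \<in> K" "y = b \<otimes> x \<oplus> a"
    using off_K_basis[OF x assms] .
  then have car: "a \<in> carrier F" "b \<in> carrier F" "x \<in> carrier F" "x \<noteq> \<zero>"
    using K_subset x by (auto simp: off_K_def)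
  \<comment> \<open>Since \<open>\<sigma> x\<close> has the valuation of \<open>x\<close>,
    \<open>v_combination\<close> applies to it too and gives the same value.\<close>
  have "off_K (\<sigma> x)"
    using x off_K_sigma[OF x] car sigma.hom_zero unfolding off_K_def by (metis sigma.hom_closed)
  then have "v (b \<otimes> \<sigma> x \<oplus> a) = v (b \<otimes> x \<oplus> a)"
    using v_combination ab(1,2) x off_K_sigma[OF x] by simp
  then show ?thesis
    using ab car by (simp add: conj_fixes)
qed

end


section \<open>The truncated valuation rings\<close>

locale truncation = ramified_quadratic_extension +
  fixes \<pi> :: 'a and r :: nat
  assumes uniformiser: "uniformiser F v \<pi>"
begin

abbreviation "\<O> \<equiv> val_ring F v"
abbreviation "Rr \<equiv> trunc_ring F v r"
abbreviation "pr \<equiv> trunc_proj F v r"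

definition e where "e = real_of_ereal (v \<pi>)"

lemma pi_facts: "\<pi> \<in> carrier F" "\<pi> \<noteq> \<zero>" "v \<pi> = ereal e" "0 < e"
proof -
  have pi: "\<pi> \<in> carrier F" "val_ideal F v = {x \<otimes> \<pi> | x. x \<in> carrier \<O>}"
    using uniformiser by (auto simp: uniformiser_def cgenideal_def)
  show "\<pi> \<in> carrier F"
    by (rule pi)
  obtain x where x: "x \<in> carrier F" "x \<noteq> \<zero>" "0 < v x"
    using exists_positive by blast
  then show nz: "\<pi> \<noteq> \<zero>"
    using pi(2) by (auto simp: val_ideal_def)
  show ve: "v \<pi> = ereal e"
    using v_real[OF pi(1) nz] by (simp add: e_def)
  have "\<one> \<otimes> \<pi> \<in> val_ideal F v"
    unfolding pi(2) by auto
  then show "0 < e"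
    using pi(1) ve by (simp add: val_ideal_def)
qed

lemma v_pi_le:
  assumes "x \<in> carrier F" "0 < v x"
  shows "ereal e \<le> v x"
proof -
  have "x \<in> val_ideal F v"
    using assms by (simp add: val_ideal_def)
  then obtain y where "y \<in> carrier F" "0 \<le> v y" "x = y \<otimes> \<pi>"
    using uniformiser by (auto simp: uniformiser_def cgenideal_def)
  then show ?thesis
    using v_mult_ge[of y \<pi> 0 "ereal e"] pi_facts by simp
qed

lemma v_pi_pow: "v (\<pi> [^] (n::nat)) = ereal (real n * e)"
  using pi_facts by (induction n) (simp_all add: v_mult algebra_simps)

lemma trunc_interval_eq: "trunc_interval F v \<pi> r = {- (real r * e)..real r * e}"
  by (simp add: trunc_interval_def v_pi_pow)

text \<open>Turns congruences modulo powers of the maximal ideal into inequalities between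
  valuations. One inclusion uses that \<open>e\<close> is the least positive value, the other that
  \<open>x\<close> is \<open>\<pi>\<close> times \<open>inv \<pi> \<otimes> x\<close>.\<close>

lemma ideal_pow_eq: "ideal_pow \<O> (val_ideal F v) n = {x \<in> carrier F. ereal (real n * e) \<le> v x}"
proof (induction n)
  case (Suc n)
  define J where "J = {x \<in> carrier F. ereal (real n * e) \<le> v x}"
  have "x \<in> carrier F \<and> ereal (real (Suc n) * e) \<le> v x" if "x \<in> ideal_prod \<O> (val_ideal F v) J" for x
    using that
  proof induction
    case (prod i j)
    then have "ereal e + ereal (real n * e) \<le> v (i \<otimes> j)"
      using v_pi_le by (intro v_mult_ge) (auto simp: J_def val_ideal_def)
    then show ?case
      using prod by (auto simp: J_def val_ideal_def algebra_simps)
  qed (auto simp: v_add_ge)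
  moreover have "x \<in> ideal_prod \<O> (val_ideal F v) J" if x: "x \<in> carrier F" "ereal (real (Suc n) * e) \<le> v x" for x
  proof -
    have "ereal (- e) + ereal (real (Suc n) * e) \<le> v (inv \<pi> \<otimes> x)"
      using x pi_facts by (intro v_mult_ge) (auto simp: v_inv)
    then have "inv \<pi> \<otimes> x \<in> J"
      using x pi_facts by (simp add: J_def algebra_simps)
    moreover have "\<pi> \<in> val_ideal F v"
      using pi_facts by (simp add: val_ideal_def)
    ultimately have "\<pi> \<otimes>\<^bsub>\<O>\<^esub> (inv \<pi> \<otimes> x) \<in> ideal_prod \<O> (val_ideal F v) J"
      by (rule ideal_prod.prod[rotated])
    moreover have "\<pi> \<otimes> (inv \<pi> \<otimes> x) = x"
      using x pi_facts m_assoc[of \<pi> "inv \<pi>" x] by simp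
    ultimately show ?thesis
      by simp
  qed
  ultimately show ?case
    unfolding ideal_pow.simps Suc[folded J_def] by blast
qed (auto simp: val_ring_def simp flip: zero_ereal_def)

section \<open>The truncated ring with its induced valuation and conjugation\<close>

definition Ir where "Ir = {x \<in> carrier F. ereal (real r * e) \<le> v x}"

lemma trunc_ring_eq: "Rr = \<O> Quot Ir"
  by (simp add: trunc_ring_def ideal_pow_eq Ir_def)

lemma pr_eq: "pr x = Ir +>\<^bsub>\<O>\<^esub> x"
  by (simp add: trunc_proj_def ideal_pow_eq Ir_def)

sublocale O: cring \<O>
  rewrites "x \<otimes>\<^bsub>\<O>\<^esub> y = x \<otimes> y" and "x \<oplus>\<^bsub>\<O>\<^esub> y = x \<oplus> y" and "\<one>\<^bsub>\<O>\<^esub> = \<one>" and "\<zero>\<^bsub>\<O>\<^esub> = \<zero>"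
  by (rule val_ring_cring) simp_all

lemma Ir_ideal: "ideal Ir \<O>"
  unfolding Ir_def by (rule val_ge_ideal) (use pi_facts in simp)

sublocale Rr: cring Rr
  unfolding trunc_ring_eq by (rule ideal.quotient_is_cring[OF Ir_ideal val_ring_cring])

sublocale pr: ring_hom_cring \<O> Rr pr
proof -
  have "pr = (+>\<^bsub>\<O>\<^esub>) Ir"
    by (rule ext) (rule pr_eq)
  then show "ring_hom_cring \<O> Rr pr"
    using ideal.rcos_ring_hom_cring[OF Ir_ideal val_ring_cring] by (simp add: trunc_ring_eq)
qed

lemma pr_surj: "C \<in> carrier Rr \<Longrightarrow> \<exists>x. x \<in> carrier F \<and> 0 \<le> v x \<and> C = pr x"
  by (auto simp: trunc_ring_eq FactRing_def A_RCOSETS_def' pr_eq)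

lemma zero_Rr: "\<zero>\<^bsub>Rr\<^esub> = Ir"
  by (simp add: trunc_ring_eq FactRing_def)

lemma pr_zero_iff:
  assumes "x \<in> carrier F" "0 \<le> v x"
  shows "pr x = \<zero>\<^bsub>Rr\<^esub> \<longleftrightarrow> ereal (real r * e) \<le> v x"
proof -
  interpret I: ideal Ir \<O>
    by (rule Ir_ideal)
  have "x \<in> Ir +>\<^bsub>\<O>\<^esub> x"
    using assms by (intro I.a_rcos_self) simp
  moreover have "Ir +>\<^bsub>\<O>\<^esub> x = Ir" if "x \<in> Ir"
    using that by (rule I.a_rcos_const)
  ultimately show ?thesis
    using assms unfolding zero_Rr pr_eq by (auto simp: Ir_def)
qed

lemma pr_eq_iff:
  assumes "x \<in> carrier F" "0 \<le> v x" "y \<in> carrier F" "0 \<le> v y"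
  shows "pr x = pr y \<longleftrightarrow> ereal (real r * e) \<le> v (x \<ominus> y)"
proof -
  have "pr x = pr y \<longleftrightarrow> pr x \<ominus>\<^bsub>Rr\<^esub> pr y = \<zero>\<^bsub>Rr\<^esub>"
    using assms by (simp add: Rr.r_right_minus_eq)
  also have "pr x \<ominus>\<^bsub>Rr\<^esub> pr y = pr (x \<ominus> y)"
    using assms pr.hom_add[of x "\<ominus> y"] pr.hom_a_inv[of y] by (simp add: a_minus_def)
  finally show ?thesis
    using assms by (simp add: pr_zero_iff v_minus_ge)
qed

lemma pr_coset: "pr x = {i \<oplus> x | i. i \<in> Ir}"
  by (auto simp: pr_eq a_r_coset_def')

lemma trunc_val_pr:
  assumes "x \<in> carrier F" "0 \<le> v x"
  shows "trunc_val F v r (pr x) = (if ereal (real r * e) \<le> v x then \<infinity> else v x)"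
proof (cases "ereal (real r * e) \<le> v x")
  case False
  have "v y = v x" if y: "y \<in> pr x" for y
  proof -
    obtain i where "i \<in> Ir" "y = i \<oplus> x"
      using y by (auto simp: pr_coset)
    then show ?thesis
      using v_add_eq[of x i] assms False by (auto simp: Ir_def a_comm)
  qed
  moreover have "x \<in> pr x"
    using assms pi_facts by (auto simp: pr_coset Ir_def v_zero intro!: exI[of _ \<zero>])
  ultimately have "v ` pr x = {v x}"
    by blast
  then show ?thesis
    using pr_zero_iff[OF assms] False unfolding trunc_val_def by simp
qed (use pr_zero_iff[OF assms] in \<open>simp add: trunc_val_def\<close>)

lemma trunc_val_nonneg: "C \<in> carrier Rr \<Longrightarrow> 0 \<le> trunc_val F v r C"
  using pr_surj[of C] by (auto simp: trunc_val_pr)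

sublocale involutive_cring F \<sigma>
  by unfold_locales (auto simp: sigma_hom sigma_invol)

text \<open>\<open>\<sigma>\<close> preserves \<open>v\<close> and is an involution, so it maps
  \<open>Ir\<close> onto itself and cosets to cosets.\<close>

lemma sigma_pr:
  assumes "x \<in> carrier F" "0 \<le> v x"
  shows "\<sigma> ` pr x = pr (\<sigma> x)"
proof -
  have "\<sigma> ` Ir = Ir"
  proof
    show "\<sigma> ` Ir \<subseteq> Ir"
      by (auto simp: Ir_def)
    show "Ir \<subseteq> \<sigma> ` Ir"
    proof
      fix y assume "y \<in> Ir"
      then show "y \<in> \<sigma> ` Ir"
        by (intro image_eqI[of _ _ "\<sigma> y"]) (auto simp: Ir_def sigma_invol)
    qed
  qed
  moreover have "\<sigma> ` pr x = {j \<oplus> \<sigma> x | j. j \<in> \<sigma> ` Ir}"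
    using assms by (force simp: pr_coset Ir_def)
  ultimately show ?thesis
    by (simp add: pr_coset)
qed

sublocale Rr: involutive_cring Rr "(`) \<sigma>"
proof
  show "(`) \<sigma> \<in> ring_hom Rr Rr"
  proof (rule ring_hom_memI)
    fix C D assume "C \<in> carrier Rr" "D \<in> carrier Rr"
    then obtain x y where xy: "x \<in> carrier F" "0 \<le> v x" "C = pr x" "y \<in> carrier F" "0 \<le> v y" "D = pr y"
      using pr_surj by metis
    show "\<sigma> ` C \<in> carrier Rr"
      using xy by (simp add: sigma_pr)
    have "\<sigma> ` pr (x \<otimes> y) = pr (\<sigma> (x \<otimes> y))"
      using xy v_mult_ge[of x y 0 0] by (intro sigma_pr) auto
    then show "\<sigma> ` (C \<otimes>\<^bsub>Rr\<^esub> D) = \<sigma> ` C \<otimes>\<^bsub>Rr\<^esub> \<sigma> ` D"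
      using xy pr.hom_mult[of x y] pr.hom_mult[of "\<sigma> x" "\<sigma> y"] by (simp add: sigma_pr)
    have "\<sigma> ` pr (x \<oplus> y) = pr (\<sigma> (x \<oplus> y))"
      using xy by (intro sigma_pr) (auto simp: v_add_ge)
    then show "\<sigma> ` (C \<oplus>\<^bsub>Rr\<^esub> D) = \<sigma> ` C \<oplus>\<^bsub>Rr\<^esub> \<sigma> ` D"
      using xy pr.hom_add[of x y] pr.hom_add[of "\<sigma> x" "\<sigma> y"] by (simp add: sigma_pr)
  next
    have "\<sigma> ` pr \<one> = pr (\<sigma> \<one>)"
      by (intro sigma_pr) auto
    then show "\<sigma> ` \<one>\<^bsub>Rr\<^esub> = \<one>\<^bsub>Rr\<^esub>"
      using pr.hom_one by simp
  qed
  fix C assume "C \<in> carrier Rr"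
  then obtain x where "x \<in> carrier F" "0 \<le> v x" "C = pr x"
    using pr_surj by metis
  then show "\<sigma> ` (\<sigma> ` C) = C"
    by (simp add: sigma_pr)
qed

subsection \<open>Reduction of matrices\<close>

abbreviation "red \<equiv> p_red F v r"

lemma red_nth [simp]: "red A $ i $ j = pr (A $ i $ j)"
  by (simp add: p_red_def)

lemma mats_O: "A \<in> mats \<O> \<longleftrightarrow> A \<in> mats F \<and> (\<forall>i j. 0 \<le> v (A $ i $ j))"
  unfolding mats_def by auto

lemma mats_OD [simp]: "A \<in> mats \<O> \<Longrightarrow> A \<in> mats F" "A \<in> mats \<O> \<Longrightarrow> 0 \<le> v (A $ i $ j)"
  by (auto simp: mats_O)

lemma dot3_O: "dot3 \<O> = dot3 F"
  by (intro ext) (simp add: dot3_def)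

lemma mat_mult_O: "A \<in> mats \<O> \<Longrightarrow> B \<in> mats \<O> \<Longrightarrow> mat_mult \<O> A B = mat_mult F A B"
  unfolding mat3_eq_iff by (simp add: O.mat_mult_nth mat_mult_nth dot3_O)

lemma mats_O_mult [simp]: "A \<in> mats \<O> \<Longrightarrow> B \<in> mats \<O> \<Longrightarrow> mat_mult F A B \<in> mats \<O>"
  using O.mats_mult[of A B] by (simp add: mat_mult_O)

lemma mats_O_one [simp]: "mat_one F \<in> mats \<O>"
  unfolding mats_def by (auto simp: v_zero)

lemma mats_O_dagger [simp]: "A \<in> mats \<O> \<Longrightarrow> dagger \<sigma> A \<in> mats \<O>"
  unfolding mats_O by simp

lemma red_mats [simp]:
  assumes "A \<in> mats \<O>"
  shows "red A \<in> mats Rr"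
proof -
  have "red A $ i $ j \<in> carrier Rr" for i j
    using assms by simp
  then show ?thesis
    unfolding mats_def by blast
qed

lemma red_surj:
  assumes "G \<in> mats Rr"
  obtains A where "A \<in> mats \<O>" "G = red A"
proof -
  have "\<forall>i j. \<exists>x. x \<in> carrier \<O> \<and> G $ i $ j = pr x"
    using pr_surj assms by auto
  then obtain f where f: "f i j \<in> carrier \<O>" "G $ i $ j = pr (f i j)" for i j
    by metis
  show thesis
  proof
    show "(\<chi> i j. f i j) \<in> mats \<O>"
      unfolding mats_def using f by simp
    show "G = red (\<chi> i j. f i j)"
      using f by (simp add: mat3_eq_iff)
  qed
qed

lemma red_mult:
  assumes "A \<in> mats \<O>" "B \<in> mats \<O>"
  shows "red (mat_mult F A B) = mat_mult Rr (red A) (red B)"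
proof -
  have "red (mat_mult \<O> A B) = mat_mult Rr (red A) (red B)"
    unfolding mat3_eq_iff
  proof (intro allI)
    fix i j
    have car: "A $ i $ k \<in> carrier \<O>" "B $ k $ j \<in> carrier \<O>" for k
      using assms by simp_all
    show "red (mat_mult \<O> A B) $ i $ j = mat_mult Rr (red A) (red B) $ i $ j"
      using assms car pr.hom_mult[OF car] pr.hom_add O.m_closed[OF car]
      by (simp add: O.mat_mult_nth Rr.mat_mult_nth dot3_def v_add_ge del: val_ring_carrier)
  qed
  then show ?thesis
    using assms by (simp add: mat_mult_O)
qed

lemma red_one [simp]: "red (mat_one F) = mat_one Rr"
  using pr.hom_zero pr.hom_one by (simp add: mat3_eq_iff)

lemma red_dagger:
  assumes "A \<in> mats \<O>"
  shows "red (dagger \<sigma> A) = dagger ((`) \<sigma>) (red A)"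
  using assms by (simp add: mat3_eq_iff sigma_pr)

lemma mat_det_O:
  assumes "A \<in> mats \<O>"
  shows "mat_det \<O> A = mat_det F A"
proof -
  have "0 \<le> v (a \<otimes> b \<otimes> c)" if "{a, b, c} \<subseteq> carrier \<O>" for a b c
    using that O.m_closed[of "a \<otimes> b" c] O.m_closed[of a b] by simp
  then show ?thesis
    using assms by (simp add: mat_det_det3 O.mat_det_det3 det3_def v_add_ge)
qed

lemma v_det_nonneg: "A \<in> mats \<O> \<Longrightarrow> 0 \<le> v (mat_det F A)"
  using O.mat_det_closed[of A] by (simp add: mat_det_O)

lemma red_det:
  assumes "A \<in> mats \<O>"
  shows "mat_det Rr (red A) = pr (mat_det F A)"
proof -
  have car: "A $ i $ j \<in> carrier \<O>" for i j
    using assms by simp_all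
  have m: "pr (a \<otimes> b \<otimes> c) = pr a \<otimes>\<^bsub>Rr\<^esub> pr b \<otimes>\<^bsub>Rr\<^esub> pr c" "a \<otimes> b \<otimes> c \<in> carrier \<O>"
    if "a \<in> carrier \<O>" "b \<in> carrier \<O>" "c \<in> carrier \<O>" for a b c
    using that pr.hom_mult[of "a \<otimes> b" c] pr.hom_mult[of a b] O.m_closed[of "a \<otimes> b" c] O.m_closed[of a b]
    by simp_all
  have s: "pr (a \<oplus> b \<oplus> c) = pr a \<oplus>\<^bsub>Rr\<^esub> pr b \<oplus>\<^bsub>Rr\<^esub> pr c" "a \<oplus> b \<oplus> c \<in> carrier \<O>"
    if "a \<in> carrier \<O>" "b \<in> carrier \<O>" "c \<in> carrier \<O>" for a b c
    using that pr.hom_add[of "a \<oplus> b" c] pr.hom_add[of a b] O.a_closed[of "a \<oplus> b" c] O.a_closed[of a b]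
    by simp_all
  have d: "pr (a \<ominus> b) = pr a \<ominus>\<^bsub>Rr\<^esub> pr b" if "a \<in> carrier \<O>" "b \<in> carrier \<O>" for a b
    using that pr.hom_add[of a "\<ominus> b"] pr.hom_a_inv[of b] by (simp add: a_minus_def)
  show ?thesis
    using assms car by (simp add: mat_det_det3 Rr.mat_det_det3 det3_def m s d del: val_ring_carrier)
qed

lemma P_iff: "g \<in> P F \<sigma> v 0 \<longleftrightarrow> g \<in> SU3 F \<sigma> \<and> g \<in> mats \<O>"
proof -
  have "V 0 $ i $ j = 0" for i j
    using exhaust_3[of i] exhaust_3[of j] by (auto simp: V_def)
  then show ?thesis
    by (auto simp: P_def mats_O zero_ereal_def)
qed

lemma P_loc_zero: "P_loc F \<sigma> v r 0 = SU3 Rr ((`) \<sigma>)"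
proof -
  have "V 0 $ i $ j = 0" for i j
    using exhaust_3[of i] exhaust_3[of j] by (auto simp: V_def)
  then show ?thesis
    by (auto simp: P_loc_def P_def trunc_val_nonneg simp flip: zero_ereal_def)
qed

lemma P_mult [simp]: "g \<in> P F \<sigma> v 0 \<Longrightarrow> h \<in> P F \<sigma> v 0 \<Longrightarrow> mat_mult F g h \<in> P F \<sigma> v 0"
  by (simp add: P_iff)

lemma P_dagger [simp]: "g \<in> P F \<sigma> v 0 \<Longrightarrow> dagger \<sigma> g \<in> P F \<sigma> v 0"
  by (simp add: P_iff)

lemma P_one [simp]: "mat_one F \<in> P F \<sigma> v 0"
  by (simp add: P_iff)

lemma red_SU3:
  assumes "g \<in> P F \<sigma> v 0"
  shows "red g \<in> SU3 Rr ((`) \<sigma>)"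
proof -
  have g: "g \<in> SU3 F \<sigma>" "g \<in> mats \<O>"
    using assms by (auto simp: P_iff)
  have "mat_mult Rr (dagger ((`) \<sigma>) (red g)) (red g) = red (mat_mult F (dagger \<sigma> g) g)"
    using g by (simp add: red_mult red_dagger)
  also have "\<dots> = mat_one Rr"
    using g by (simp add: SU3_iff)
  finally show ?thesis
    using g pr.hom_one by (simp add: Rr.SU3_iff red_det SU3_iff)
qed

end


section \<open>Surjectivity of the reduction\<close>

definition E :: "real \<Rightarrow> 3 \<Rightarrow> real" where
  "E x j = (if j = 1 then x / 2 else if j = 2 then 0 else - x / 2)"

lemma E_simps [simp]: "E x 1 = x / 2" "E x 2 = 0" "E x 3 = - x / 2"
  by (simp_all add: E_def)

lemma E_reflect: "E x (4 - j) = - E x j"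
  using exhaust_3[of j] by auto

lemma V_nth: "V x $ i $ j = E x j - E x i"
  using exhaust_3[of i] exhaust_3[of j] by (auto simp: V_def)

lemma ereal_le_plus_iff: "ereal a \<le> w + ereal b \<longleftrightarrow> ereal (a - b) \<le> w"
  by (cases w) auto

context truncation
begin

section \<open>Units and determinants modulo a power of the maximal ideal\<close>

lemma prod3_pos:
  assumes "a \<in> carrier F" "b \<in> carrier F" "c \<in> carrier F" "0 \<le> v a" "0 \<le> v b" "0 \<le> v c"
    and "0 < v a \<or> 0 < v b \<or> 0 < v c"
  shows "0 < v (a \<otimes> b \<otimes> c)"
  using assms by (auto simp: v_mult add_nonneg_pos add_pos_nonneg)

text \<open>Each product in Sarrus' rule has a factor from every column.\<close>

lemma det_column_pos:
  assumes A: "A \<in> mats \<O>" and pos: "\<And>i. 0 < v (A $ i $ j)"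
  shows "0 < v (mat_det F A)"
proof -
  have "j = 1 \<or> j = 2 \<or> j = 3"
    by (rule exhaust_3)
  then show ?thesis
    using A pos unfolding mat_det_det3[OF mats_OD(1)[OF A]] det3_def minus_eq
    by (elim disjE) (intro v_add_gr; simp add: v_add_gr prod3_pos)+
qed

lemma minus_minus_self:
  assumes "x \<in> carrier F" "y \<in> carrier F"
  shows "x \<oplus> \<ominus> (x \<ominus> y) = y"
  using assms by algebra

lemma red_det_unit:
  assumes A: "A \<in> mats \<O>" and "mat_det Rr (red A) = \<one>\<^bsub>Rr\<^esub>" "0 < r"
  shows "\<not> 0 < v (mat_det F A)"
proof
  assume pos: "0 < v (mat_det F A)"
  let ?d = "mat_det F A"
  have "pr ?d = pr \<one>"
    using assms pr.hom_one by (simp add: red_det)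
  then have "ereal (real r * e) \<le> v (?d \<ominus> \<one>)"
    using A pr_eq_iff[of ?d \<one>] by (simp add: v_det_nonneg)
  moreover have "0 < ereal (real r * e)"
    using assms pi_facts by simp
  ultimately have "0 < v (?d \<ominus> \<one>)"
    by (rule order_less_le_trans[rotated])
  \<comment> \<open>The determinant is congruent to 1, so 1 would be a difference of two elements of
    the maximal ideal.\<close>
  then have "0 < v (?d \<oplus> \<ominus> (?d \<ominus> \<one>))"
    using A pos by (intro v_add_gr) auto
  moreover have "?d \<oplus> \<ominus> (?d \<ominus> \<one>) = \<one>"
    using A by (intro minus_minus_self) simp_all
  ultimately show False
    by simp
qed

text \<open>A product congruent to 1 cannot have positive valuation. For \<open>r = 0\<close> the
  truncated ring is trivial and every class is a unit, whence \<open>0 < r\<close>.\<close>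

lemma pr_UnitsD:
  assumes x: "x \<in> carrier F" "0 \<le> v x" and "pr x \<in> Units Rr" "0 < r"
  shows "v x = 0"
proof (rule ccontr)
  assume "v x \<noteq> 0"
  then have pos: "0 < v x"
    using x by simp
  obtain y where y: "y \<in> carrier F" "0 \<le> v y" "inv\<^bsub>Rr\<^esub> pr x = pr y"
    using pr_surj[of "inv\<^bsub>Rr\<^esub> pr x"] assms by auto
  have xy: "x \<otimes> y \<in> carrier F" "0 < v (x \<otimes> y)"
    using x y pos by (auto simp: v_mult add_pos_nonneg)
  have "pr (x \<otimes> y) = pr \<one>"
    using x y assms(3) pr.hom_mult[of x y] pr.hom_one by (simp flip: y(3))
  then have "ereal (real r * e) \<le> v (x \<otimes> y \<ominus> \<one>)"
    using xy pr_eq_iff[of "x \<otimes> y" \<one>] by simp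
  moreover have "0 < ereal (real r * e)"
    using assms pi_facts by simp
  ultimately have "0 < v (x \<otimes> y \<ominus> \<one>)"
    by (rule order_less_le_trans[rotated])
  then have "0 < v (x \<otimes> y \<oplus> \<ominus> (x \<otimes> y \<ominus> \<one>))"
    using xy by (intro v_add_gr) auto
  moreover have "x \<otimes> y \<oplus> \<ominus> (x \<otimes> y \<ominus> \<one>) = \<one>"
    using xy(1) by (intro minus_minus_self) simp_all
  ultimately show False
    by simp
qed

lemma v_zero_nonzero: "v x = 0 \<Longrightarrow> x \<noteq> \<zero>"
  using v_zero by auto

lemma pr_inv:
  assumes "x \<in> carrier F" "v x = 0"
  shows "pr (inv x) = inv\<^bsub>Rr\<^esub> pr x" "pr x \<in> Units Rr"
proof -
  note nz = v_zero_nonzero[OF assms(2)]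
  have i: "inv x \<in> carrier F" "v (inv x) = 0"
    using assms nz by (auto simp: v_inv)
  have eq: "pr x \<otimes>\<^bsub>Rr\<^esub> pr (inv x) = \<one>\<^bsub>Rr\<^esub>"
    using assms i nz pr.hom_mult[of x "inv x"] pr.hom_one by simp
  have car: "pr x \<in> carrier Rr" "pr (inv x) \<in> carrier Rr"
    using assms i by simp_all
  show "pr (inv x) = inv\<^bsub>Rr\<^esub> pr x"
    using Rr.comm_inv_char[OF car eq] by simp
  show "pr x \<in> Units Rr"
    using car eq Rr.m_comm[OF car] unfolding Units_def by auto
qed

lemma unit_params:
  assumes "x \<in> carrier F" "v x = 0"
  shows "inv x \<in> carrier F" "v (inv x) = 0" "v (\<sigma> x) = 0" "inv (\<sigma> x) \<in> carrier F" "v (inv (\<sigma> x)) = 0"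
    "x \<in> Units F"
proof -
  have nz: "x \<noteq> \<zero>" "\<sigma> x \<noteq> \<zero>"
    using v_zero_nonzero[OF assms(2)] v_zero_nonzero[of "\<sigma> x"] assms by auto
  then show "inv x \<in> carrier F" "v (inv x) = 0" "v (\<sigma> x) = 0" "inv (\<sigma> x) \<in> carrier F" "v (inv (\<sigma> x)) = 0"
    "x \<in> Units F"
    using assms by (auto simp: v_inv nonzero_Units)
qed

section \<open>Reduction of diagonal, antidiagonal and unipotent matrices\<close>

lemma mats_O_mat3:
  "mat3 a b c d f g h k l \<in> mats \<O> \<longleftrightarrow> {a, b, c, d, f, g, h, k, l} \<subseteq> {x \<in> carrier F. 0 \<le> v x}"
  unfolding mats_def by (auto simp: forall_3)

lemma red_T:
  assumes "x \<in> carrier F" "v x = 0"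
  shows "T_mat F \<sigma> x \<in> P F \<sigma> v 0" "red (T_mat F \<sigma> x) = T_mat Rr ((`) \<sigma>) (pr x)"
proof -
  note u = unit_params[OF assms]
  show "T_mat F \<sigma> x \<in> P F \<sigma> v 0"
    using u assms T_mat_SU3[of x] by (auto simp: P_iff T_mat_def mats_O_mat3 v_mult v_zero)
  have "pr (inv x \<otimes> \<sigma> x) = pr (inv x) \<otimes>\<^bsub>Rr\<^esub> pr (\<sigma> x)"
    using u assms pr.hom_mult[of "inv x" "\<sigma> x"] by simp
  then show "red (T_mat F \<sigma> x) = T_mat Rr ((`) \<sigma>) (pr x)"
    unfolding mat3_eq_iff forall_3 using u assms pr.hom_zero
    by (simp add: T_mat_def pr_inv sigma_pr)
qed

lemma red_M:
  assumes "x \<in> carrier F" "v x = 0"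
  shows "M_mat F \<sigma> x \<in> P F \<sigma> v 0" "red (M_mat F \<sigma> x) = M_mat Rr ((`) \<sigma>) (pr x)"
proof -
  note u = unit_params[OF assms]
  show "M_mat F \<sigma> x \<in> P F \<sigma> v 0"
    using u assms M_mat_SU3[of x] by (auto simp: P_iff M_mat_def mats_O_mat3 v_mult v_zero)
  have "pr (inv x \<otimes> \<sigma> x) = pr (inv x) \<otimes>\<^bsub>Rr\<^esub> pr (\<sigma> x)"
    using u assms pr.hom_mult[of "inv x" "\<sigma> x"] by simp
  moreover have "pr (\<ominus> (inv x \<otimes> \<sigma> x)) = \<ominus>\<^bsub>Rr\<^esub> pr (inv x \<otimes> \<sigma> x)"
    using u assms pr.hom_a_inv[of "inv x \<otimes> \<sigma> x"] by (simp add: v_mult)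
  ultimately show "red (M_mat F \<sigma> x) = M_mat Rr ((`) \<sigma>) (pr x)"
    unfolding mat3_eq_iff forall_3 using u assms pr.hom_zero
    by (simp add: M_mat_def pr_inv sigma_pr)
qed

lemma red_U:
  assumes "unip_param F \<sigma> b c" "0 \<le> v b" "0 \<le> v c"
  shows "U_mat F \<sigma> b c \<in> P F \<sigma> v 0" "red (U_mat F \<sigma> b c) = U_mat Rr ((`) \<sigma>) (pr b) (pr c)"
proof -
  have car: "b \<in> carrier F" "c \<in> carrier F"
    using assms by (auto simp: unip_param_def)
  show "U_mat F \<sigma> b c \<in> P F \<sigma> v 0"
    using car assms U_mat_SU3[of b c] by (auto simp: P_iff U_mat_def mats_O_mat3 v_zero)
  have "pr (\<ominus> \<sigma> b) = \<ominus>\<^bsub>Rr\<^esub> pr (\<sigma> b)"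
    using car assms pr.hom_a_inv[of "\<sigma> b"] by simp
  then show "red (U_mat F \<sigma> b c) = U_mat Rr ((`) \<sigma>) (pr b) (pr c)"
    unfolding mat3_eq_iff forall_3 using car assms pr.hom_zero pr.hom_one
    by (simp add: U_mat_def sigma_pr)
qed

lemma red_L:
  assumes "unip_param F \<sigma> b c" "0 \<le> v b" "0 \<le> v c"
  shows "L_mat F \<sigma> b c \<in> P F \<sigma> v 0" "red (L_mat F \<sigma> b c) = L_mat Rr ((`) \<sigma>) (pr b) (pr c)"
proof -
  have car: "b \<in> carrier F" "c \<in> carrier F"
    using assms by (auto simp: unip_param_def)
  show "L_mat F \<sigma> b c \<in> P F \<sigma> v 0"
    using car assms L_mat_SU3[of b c] by (auto simp: P_iff L_mat_def mats_O_mat3 v_zero)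
  have "pr (\<ominus> \<sigma> b) = \<ominus>\<^bsub>Rr\<^esub> pr (\<sigma> b)"
    using car assms pr.hom_a_inv[of "\<sigma> b"] by simp
  then show "red (L_mat F \<sigma> b c) = L_mat Rr ((`) \<sigma>) (pr b) (pr c)"
    unfolding mat3_eq_iff forall_3 using car assms pr.hom_zero pr.hom_one
    by (simp add: L_mat_def sigma_pr)
qed

text \<open>Lift both parameters arbitrarily. The failure \<open>s\<close> of the relation is fixed
  by \<open>\<sigma>\<close> and vanishes in the truncated ring, so subtracting half of it from
  \<open>c\<close> restores the relation without changing the reduction.\<close>

lemma lift_unip_param:
  assumes "unip_param Rr ((`) \<sigma>) B C"
  obtains b c where "unip_param F \<sigma> b c" "0 \<le> v b" "0 \<le> v c" "pr b = B" "pr c = C"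
proof -
  obtain b where b: "b \<in> carrier F" "0 \<le> v b" "B = pr b"
    using pr_surj[of B] assms by (auto simp: unip_param_def)
  obtain c where c: "c \<in> carrier F" "0 \<le> v c" "C = pr c"
    using pr_surj[of C] assms by (auto simp: unip_param_def)
  define s where "s = c \<oplus> \<sigma> c \<oplus> \<sigma> b \<otimes> b"
  have sb: "\<sigma> b \<otimes> b \<in> carrier F" "0 \<le> v (\<sigma> b \<otimes> b)" and sc: "c \<oplus> \<sigma> c \<in> carrier F" "0 \<le> v (c \<oplus> \<sigma> c)"
    using b c by (auto simp: v_mult v_add_ge)
  have s: "s \<in> carrier F" "0 \<le> v s" "\<sigma> s = s"
    using b c sb sc by (auto simp: s_def v_add_ge m_comm a_comm)
  have "pr s = \<zero>\<^bsub>Rr\<^esub>"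
    using assms b c sb sc pr.hom_add[of "c \<oplus> \<sigma> c" "\<sigma> b \<otimes> b"] pr.hom_add[of c "\<sigma> c"] pr.hom_mult[of "\<sigma> b" b]
    by (simp add: s_def unip_param_def sigma_pr)
  then have vs: "ereal (real r * e) \<le> v s"
    using s by (simp add: pr_zero_iff)
  \<comment> \<open>One half, of valuation 0 by odd residue characteristic and fixed by
    \<open>\<sigma>\<close>.\<close>
  define h where "h = inv (\<one> \<oplus> \<one>)"
  have two: "\<one> \<oplus> \<one> \<in> carrier F" "v (\<one> \<oplus> \<one>) = 0"
    by (simp_all add: v_two)
  have h: "h \<in> carrier F" "v h = 0" "(\<one> \<oplus> \<one>) \<otimes> h = \<one>" "\<sigma> h = h"
    using unit_params[OF two] v_zero_nonzero[OF two(2)] by (auto simp: h_def)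
  define d where "d = s \<otimes> h"
  have d: "d \<in> carrier F" "v d = v s" "\<sigma> d = d" "d \<oplus> d = s"
  proof -
    have "d \<oplus> d = s \<otimes> ((\<one> \<oplus> \<one>) \<otimes> h)"
      using s(1) h(1) by (simp add: d_def l_distr r_distr)
    then show "d \<oplus> d = s"
      unfolding h(3) using s by simp
  qed (use s h in \<open>auto simp: d_def v_mult\<close>)
  show thesis
  proof (rule that[of b "c \<ominus> d"])
    have "(c \<ominus> d) \<oplus> \<sigma> (c \<ominus> d) \<oplus> \<sigma> b \<otimes> b = s \<ominus> (d \<oplus> d)"
    proof -
      have "c \<ominus> d \<oplus> (c' \<ominus> d) \<oplus> n = c \<oplus> c' \<oplus> n \<ominus> (d \<oplus> d)" if "c' \<in> carrier F" "n \<in> carrier F" for c' n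
        using c(1) d(1) that by algebra
      then show ?thesis
        using b c d by (simp add: s_def)
    qed
    then show "unip_param F \<sigma> b (c \<ominus> d)"
      using b c d s by (simp add: unip_param_def r_neg minus_eq)
    show "0 \<le> v (c \<ominus> d)"
      using c d s by (simp add: v_minus_ge)
    have "c \<ominus> d \<ominus> c = \<ominus> d"
      using c(1) d(1) by algebra
    then show "pr (c \<ominus> d) = C"
      using c d s vs pr_eq_iff[of "c \<ominus> d" c] by (simp add: v_minus_ge)
  qed (use b in auto)
qed

lemma red_SU3_mult:
  assumes "G \<in> red ` P F \<sigma> v 0" "H \<in> red ` P F \<sigma> v 0"
  shows "mat_mult Rr G H \<in> red ` P F \<sigma> v 0"
proof -
  obtain g h where gh: "g \<in> P F \<sigma> v 0" "h \<in> P F \<sigma> v 0" "G = red g" "H = red h"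
    using assms by auto
  then have "mat_mult Rr G H = red (mat_mult F g h)"
    by (simp add: red_mult P_iff)
  then show ?thesis
    using gh by simp
qed

lemma red_image_unit:
  assumes G: "G \<in> SU3 Rr ((`) \<sigma>)" and unit: "G $ 1 $ 1 \<in> Units Rr" and r: "0 < r"
  shows "G \<in> red ` P F \<sigma> v 0"
proof -
  obtain B C B' C' where dec: "unip_param Rr ((`) \<sigma>) B C" "unip_param Rr ((`) \<sigma>) B' C'"
    "G = mat_mult Rr (L_mat Rr ((`) \<sigma>) B C) (mat_mult Rr (T_mat Rr ((`) \<sigma>) (G $ 1 $ 1)) (U_mat Rr ((`) \<sigma>) B' C'))"
    using Rr.SU3_decomposition[OF G unit] .
  obtain a where a: "a \<in> carrier F" "0 \<le> v a" "G $ 1 $ 1 = pr a"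
    using pr_surj[of "G $ 1 $ 1"] G by auto
  have "v a = 0"
    using a unit r pr_UnitsD by simp
  then have T: "T_mat Rr ((`) \<sigma>) (G $ 1 $ 1) \<in> red ` P F \<sigma> v 0"
    unfolding a(3) using a(1) red_T[of a] by (auto intro: image_eqI[of _ _ "T_mat F \<sigma> a"])
  obtain b c where "unip_param F \<sigma> b c" "0 \<le> v b" "0 \<le> v c" "pr b = B" "pr c = C"
    using lift_unip_param[OF dec(1)] .
  then have L: "L_mat Rr ((`) \<sigma>) B C \<in> red ` P F \<sigma> v 0"
    using red_L[of b c] by (auto intro: image_eqI[of _ _ "L_mat F \<sigma> b c"])
  obtain b' c' where "unip_param F \<sigma> b' c'" "0 \<le> v b'" "0 \<le> v c'" "pr b' = B'" "pr c' = C'"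
    using lift_unip_param[OF dec(2)] .
  then have U: "U_mat Rr ((`) \<sigma>) B' C' \<in> red ` P F \<sigma> v 0"
    using red_U[of b' c'] by (auto intro: image_eqI[of _ _ "U_mat F \<sigma> b' c'"])
  show ?thesis
    by (subst dec(3)) (intro red_SU3_mult L T U)
qed

lemma red_image: "red ` P F \<sigma> v 0 = SU3 Rr ((`) \<sigma>)"
proof (intro equalityI subsetI)
  fix G assume G: "G \<in> SU3 Rr ((`) \<sigma>)"
  obtain A where A: "A \<in> mats \<O>" "G = red A"
    using red_surj[of G] G by auto
  show "G \<in> red ` P F \<sigma> v 0"
  proof (cases "r = 0")
    case True
    \<comment> \<open>The truncated ring is trivial, so all matrices over it coincide.\<close>
    have "pr z = \<zero>\<^bsub>Rr\<^esub>" if "z \<in> carrier F" "0 \<le> v z" for z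
      using that True pr_zero_iff[of z] by (simp flip: zero_ereal_def)
    then have "pr (A $ i $ j) = pr (mat_one F $ i $ j)" for i j
      using mats_OD[OF A(1)] by (simp add: v_zero)
    then have "G = red (mat_one F)"
      unfolding A(2) mat3_eq_iff red_nth by blast
    then show ?thesis
      using P_one by (rule image_eqI)
  next
    case False
    then have r: "0 < r"
      by simp
    have units: "pr (A $ i $ j) \<in> Units Rr" if "\<not> 0 < v (A $ i $ j)" for i j
    proof -
      have "v (A $ i $ j) = 0"
        using that mats_OD(2)[OF A(1), of i j] by (intro antisym) (simp_all only: not_less)
      then show ?thesis
        using A by (intro pr_inv) simp_all
    qed
    consider "G $ 1 $ 1 \<in> Units Rr" | "G $ 3 $ 1 \<in> Units Rr"
    proof -
      \<comment> \<open>If both corners of the first column had positive valuation, its isotropy in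
        the truncated ring would force \<open>\<sigma> b \<otimes> b\<close>, hence the middle entry
        \<open>b\<close>, to have positive valuation as well, contradicting determinant 1.\<close>
      have "\<not> (0 < v (A $ 1 $ 1) \<and> 0 < v (A $ 3 $ 1))"
      proof
        assume pos: "0 < v (A $ 1 $ 1) \<and> 0 < v (A $ 3 $ 1)"
        define a where "a = A $ 1 $ 1"
        define b where "b = A $ 2 $ 1"
        define c where "c = A $ 3 $ 1"
        have abc: "a \<in> carrier F" "b \<in> carrier F" "c \<in> carrier F" "0 < v a" "0 < v c" "0 \<le> v b" "0 \<le> v a" "0 \<le> v c"
          using pos A by (auto simp: a_def b_def c_def)
        have O: "\<sigma> c \<otimes> a \<in> carrier \<O>" "\<sigma> b \<otimes> b \<in> carrier \<O>" "\<sigma> a \<otimes> c \<in> carrier \<O>"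
          using abc by (simp_all add: v_mult)
        have "pr (\<sigma> c \<otimes> a \<oplus> \<sigma> b \<otimes> b \<oplus> \<sigma> a \<otimes> c) = \<zero>\<^bsub>Rr\<^esub>"
          using Rr.SU3_column_relation[OF G, of 1 1] abc O pr.hom_add[OF O.a_closed[OF O(1,2)] O(3)]
            pr.hom_add[OF O(1,2)] pr.hom_mult[of "\<sigma> c" a] pr.hom_mult[of "\<sigma> b" b] pr.hom_mult[of "\<sigma> a" c]
          by (simp add: A(2) sigma_pr flip: a_def b_def c_def)
        then have "ereal (real r * e) \<le> v (\<sigma> c \<otimes> a \<oplus> \<sigma> b \<otimes> b \<oplus> \<sigma> a \<otimes> c)"
          using O abc by (subst (asm) pr_zero_iff) (auto simp: v_add_ge)
        moreover have "0 < ereal (real r * e)"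
          using r pi_facts by simp
        ultimately have s: "0 < v (\<sigma> c \<otimes> a \<oplus> \<sigma> b \<otimes> b \<oplus> \<sigma> a \<otimes> c)"
          by (rule order_less_le_trans[rotated])
        have "0 < v ((\<sigma> c \<otimes> a \<oplus> \<sigma> b \<otimes> b \<oplus> \<sigma> a \<otimes> c) \<oplus> \<ominus> (\<sigma> c \<otimes> a \<oplus> \<sigma> a \<otimes> c))"
        proof (rule v_add_gr)
          have "0 < v (\<sigma> c \<otimes> a \<oplus> \<sigma> a \<otimes> c)"
            using abc by (intro v_add_gr) (auto simp: v_mult add_pos_nonneg)
          then show "0 < v (\<ominus> (\<sigma> c \<otimes> a \<oplus> \<sigma> a \<otimes> c))"
            using abc by simp
        qed (use abc s in auto)
        moreover have "(\<sigma> c \<otimes> a \<oplus> \<sigma> b \<otimes> b \<oplus> \<sigma> a \<otimes> c) \<oplus> \<ominus> (\<sigma> c \<otimes> a \<oplus> \<sigma> a \<otimes> c) = \<sigma> b \<otimes> b"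
          using O unfolding val_ring_carrier by algebra
        ultimately have "0 < v b + v b"
          using abc by (simp add: v_mult)
        then have "0 < v b"
          using abc(6) by (cases "v b") auto
        then have "0 < v (A $ i $ 1)" for i
          using abc exhaust_3[of i] by (auto simp: a_def b_def c_def)
        then have "0 < v (mat_det F A)"
          by (rule det_column_pos[OF A(1)])
        then show False
          using red_det_unit[OF A(1)] G r by (simp add: Rr.SU3_iff A(2))
      qed
      then show thesis
        using that units A(2) by auto
    qed
    then show ?thesis
    proof cases
      case 1
      then show ?thesis
        using red_image_unit G r by blast
    next
      case 2
      \<comment> \<open>The antidiagonal matrix moves row 3 of \<open>G\<close> to row 1, which
        reduces this to the first case.\<close>
      let ?m = "M_mat F \<sigma> \<one>"
      let ?M = "M_mat Rr ((`) \<sigma>) \<one>\<^bsub>Rr\<^esub>"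
      have m: "?m \<in> P F \<sigma> v 0" "red ?m = ?M"
        using red_M[of \<one>] pr.hom_one by simp_all
      have M: "?M \<in> SU3 Rr ((`) \<sigma>)"
        by (simp add: Rr.M_mat_SU3)
      have "mat_mult Rr ?M G $ 1 $ 1 = G $ 3 $ 1"
        using M G by (simp add: Rr.mat_mult_nth dot3_def) (simp add: M_mat_def)
      then have "mat_mult Rr ?M G \<in> red ` P F \<sigma> v 0"
        using red_image_unit[of "mat_mult Rr ?M G"] 2 M G r by simp
      moreover have "dagger ((`) \<sigma>) ?M \<in> red ` P F \<sigma> v 0"
        using m by (auto simp: P_iff simp flip: red_dagger m(2) intro!: imageI)
      ultimately have "mat_mult Rr (dagger ((`) \<sigma>) ?M) (mat_mult Rr ?M G) \<in> red ` P F \<sigma> v 0"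
        by (rule red_SU3_mult[rotated])
      then show ?thesis
        using M G by simp
    qed
  qed
qed (auto simp: red_SU3)

end


section \<open>Gluing relations and the tree\<close>

text \<open>The relation sees the two group elements only through \<open>inv g \<otimes> h\<close>,
  which a left translation does not change.\<close>

lemma glue_rel_translate:
  assumes "group G" "subgroup A G" "k \<in> A" "g \<in> A" "h \<in> A"
  shows "((k \<otimes>\<^bsub>G\<^esub> g, x), (k \<otimes>\<^bsub>G\<^esub> h, y)) \<in> glue_rel G A I N \<nu> Q \<longleftrightarrow> ((g, x), (h, y)) \<in> glue_rel G A I N \<nu> Q"
proof -
  interpret group G by fact
  interpret subgroup A G by fact
  have car: "k \<in> carrier G" "g \<in> carrier G" "h \<in> carrier G"
    using assms by auto
  have "inv\<^bsub>G\<^esub> k \<otimes>\<^bsub>G\<^esub> (k \<otimes>\<^bsub>G\<^esub> h) = h"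
    using car by (simp flip: m_assoc)
  then have "inv\<^bsub>G\<^esub> (k \<otimes>\<^bsub>G\<^esub> g) \<otimes>\<^bsub>G\<^esub> (k \<otimes>\<^bsub>G\<^esub> h) = inv\<^bsub>G\<^esub> g \<otimes>\<^bsub>G\<^esub> h"
    using car by (simp add: inv_mult_group m_assoc)
  then show ?thesis
    using assms by (simp add: glue_rel_def)
qed

lemma left_act_glue_class:
  assumes G: "group G" and A: "subgroup A G" and k: "k \<in> A" and g: "g \<in> A"
  shows "left_act G k (glue_rel G A I N \<nu> Q `` {(g, x)}) = glue_rel G A I N \<nu> Q `` {(k \<otimes>\<^bsub>G\<^esub> g, x)}"
proof (intro equalityI subsetI)
  interpret group G by fact
  interpret subgroup A G by fact
  fix c
  show "c \<in> glue_rel G A I N \<nu> Q `` {(k \<otimes>\<^bsub>G\<^esub> g, x)}" if c: "c \<in> left_act G k (glue_rel G A I N \<nu> Q `` {(g, x)})"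
  proof -
    obtain h y where hy: "((g, x), (h, y)) \<in> glue_rel G A I N \<nu> Q" "c = (k \<otimes>\<^bsub>G\<^esub> h, y)"
      using c by (auto simp: left_act_def)
    moreover have "h \<in> A"
      using hy by (simp add: glue_rel_def)
    ultimately show ?thesis
      using glue_rel_translate[OF G A k g] by simp
  qed
  show "c \<in> left_act G k (glue_rel G A I N \<nu> Q `` {(g, x)})" if c: "c \<in> glue_rel G A I N \<nu> Q `` {(k \<otimes>\<^bsub>G\<^esub> g, x)}"
  proof -
    obtain h y where hy: "((k \<otimes>\<^bsub>G\<^esub> g, x), (h, y)) \<in> glue_rel G A I N \<nu> Q" "c = (h, y)"
      using c by (cases c) auto
    define h' where "h' = inv\<^bsub>G\<^esub> k \<otimes>\<^bsub>G\<^esub> h"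
    have h: "h \<in> A"
      using hy by (simp add: glue_rel_def)
    then have h': "h' \<in> A" "h = k \<otimes>\<^bsub>G\<^esub> h'"
      using k by (auto simp: h'_def simp flip: m_assoc)
    then have "((g, x), (h', y)) \<in> glue_rel G A I N \<nu> Q"
      using hy glue_rel_translate[OF G A k g] by simp
    then show ?thesis
      unfolding left_act_def hy(2) h'(2) by (intro image_eqI[of _ _ "(h', y)"]) auto
  qed
qed

lemma (in involutive_cring) SU3_subgroup: "subgroup (SU3 R \<tau>) (SL3 R)"
proof -
  interpret group "SL3 R"
    by (rule SL3_group)
  have "SU3 R \<tau> \<noteq> {}"
    using SU3_one by blast
  then show ?thesis
    by (intro subgroupI) (auto simp: inv_SU3)
qed

section \<open>Bounds on matrix entries and right multiplication by \<open>N\<close>\<close>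

context truncation
begin

lemma v_eq_ereal:
  assumes "a \<in> carrier F" "a \<noteq> \<zero>"
  obtains \<alpha> where "v a = ereal \<alpha>" "v (inv a) = ereal (- \<alpha>)" "v (\<sigma> a) = ereal \<alpha>" "v (inv (\<sigma> a)) = ereal (- \<alpha>)"
    "inv a \<in> carrier F" "inv (\<sigma> a) \<in> carrier F" "real_of_ereal (v a) = \<alpha>"
proof -
  have s: "\<sigma> a \<in> carrier F" "\<sigma> a \<noteq> \<zero>"
    using assms \<tau>_invol[of a] sigma.hom_zero by fastforce+
  obtain \<alpha> where "v a = ereal \<alpha>"
    using v_real[OF assms] by metis
  then show thesis
    using that[of \<alpha>] s assms by (simp add: v_inv)
qed

lemma N_grp_cases:
  assumes "n \<in> N_grp F \<sigma>"
  obtains a where "a \<in> carrier F" "a \<noteq> \<zero>" "n = T_mat F \<sigma> a" | a where "a \<in> carrier F" "a \<noteq> \<zero>" "n = M_mat F \<sigma> a"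
  using assms by (auto simp: N_grp_def T_grp_def M_set_def)

lemma N_grp_SU3: "n \<in> N_grp F \<sigma> \<Longrightarrow> n \<in> SU3 F \<sigma>"
  by (auto elim!: N_grp_cases intro!: T_mat_SU3 M_mat_SU3 nonzero_Units)

lemma nu_T:
  assumes "a \<in> carrier F" "a \<noteq> \<zero>"
  shows "nu F \<sigma> v (T_mat F \<sigma> a) x = x - 2 * real_of_ereal (v a)"
proof -
  \<comment> \<open>\<open>nu\<close> distinguishes the two kinds of matrices by membership in
    \<open>M_set\<close>; a diagonal one is excluded by its nonzero entry (1,1).\<close>
  have "T_mat F \<sigma> a \<noteq> M_mat F \<sigma> b" for b
    using assms by (auto simp: mat3_eq_iff forall_3 T_mat_def M_mat_def)
  then show ?thesis
    by (auto simp: nu_def M_set_def T_mat_def)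
qed

lemma nu_M:
  assumes "a \<in> carrier F" "a \<noteq> \<zero>"
  shows "nu F \<sigma> v (M_mat F \<sigma> a) x = - 2 * real_of_ereal (v a) - x"
  using assms by (auto simp: nu_def M_set_def M_mat_def reflection_def)

text \<open>Rows are measured at \<open>x\<close> and columns at \<open>y\<close>. The case
  \<open>x = y\<close> is the bound defining \<open>P\<close>; with two parameters the bounds
  compose and invert like maps between \<open>x\<close> and \<open>y\<close>.\<close>

definition bound :: "'a ^ 3 ^ 3 \<Rightarrow> real \<Rightarrow> real \<Rightarrow> bool" where
  "bound g x y \<longleftrightarrow> (\<forall>i j. ereal (E y j - E x i) \<le> v (g $ i $ j))"

lemma bound_shift:
  assumes g: "g \<in> mats F" and n: "n \<in> N_grp F \<sigma>"
  shows "(\<forall>i j. ereal (V x $ i $ j) \<le> v (mat_mult F g n $ i $ j)) \<longleftrightarrow> bound g x (nu F \<sigma> v n x)"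
proof -
  have nm: "n \<in> mats F"
    using N_grp_SU3[OF n] by simp
  have "(\<forall>j. ereal (E x j - E x i) \<le> v (mat_mult F g n $ i $ j)) \<longleftrightarrow>
      (\<forall>j. ereal (E (nu F \<sigma> v n x) j - E x i) \<le> v (g $ i $ j))" for i
    using n
  proof (cases rule: N_grp_cases)
    case (1 a)
    obtain \<alpha> where \<alpha>: "v a = ereal \<alpha>" "v (inv a) = ereal (- \<alpha>)" "v (\<sigma> a) = ereal \<alpha>" "v (inv (\<sigma> a)) = ereal (- \<alpha>)"
      "inv a \<in> carrier F" "inv (\<sigma> a) \<in> carrier F" "real_of_ereal (v a) = \<alpha>"
      using v_eq_ereal[OF 1(1,2)] .
    have m: "mat_mult F g n $ i $ 1 = g $ i $ 1 \<otimes> a" "mat_mult F g n $ i $ 2 = g $ i $ 2 \<otimes> (inv a \<otimes> \<sigma> a)"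
      "mat_mult F g n $ i $ 3 = g $ i $ 3 \<otimes> inv (\<sigma> a)"
      using g nm 1(1) \<alpha> by (simp_all add: mat_mult_nth dot3_def) (simp_all add: 1(3) T_mat_def)
    have vm: "v (mat_mult F g n $ i $ 1) = v (g $ i $ 1) + ereal \<alpha>" "v (mat_mult F g n $ i $ 2) = v (g $ i $ 2)"
      "v (mat_mult F g n $ i $ 3) = v (g $ i $ 3) + ereal (- \<alpha>)"
      unfolding m using g 1(1) \<alpha> by (simp_all add: v_mult)
    have nu: "nu F \<sigma> v n x = x - 2 * \<alpha>"
      using 1 \<alpha> by (simp add: nu_T)
    show ?thesis
      unfolding forall_3 vm nu ereal_le_plus_iff E_simps by (simp add: diff_divide_distrib algebra_simps)
  next
    case (2 a)
    obtain \<alpha> where \<alpha>: "v a = ereal \<alpha>" "v (inv a) = ereal (- \<alpha>)" "v (\<sigma> a) = ereal \<alpha>" "v (inv (\<sigma> a)) = ereal (- \<alpha>)"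
      "inv a \<in> carrier F" "inv (\<sigma> a) \<in> carrier F" "real_of_ereal (v a) = \<alpha>"
      using v_eq_ereal[OF 2(1,2)] .
    have m: "mat_mult F g n $ i $ 1 = g $ i $ 3 \<otimes> inv (\<sigma> a)" "mat_mult F g n $ i $ 2 = g $ i $ 2 \<otimes> \<ominus> (inv a \<otimes> \<sigma> a)"
      "mat_mult F g n $ i $ 3 = g $ i $ 1 \<otimes> a"
      using g nm 2(1) \<alpha> by (simp_all add: mat_mult_nth dot3_def) (simp_all add: 2(3) M_mat_def)
    have vm: "v (mat_mult F g n $ i $ 1) = v (g $ i $ 3) + ereal (- \<alpha>)" "v (mat_mult F g n $ i $ 2) = v (g $ i $ 2)"
      "v (mat_mult F g n $ i $ 3) = v (g $ i $ 1) + ereal \<alpha>"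
      unfolding m using g 2(1) \<alpha> by (simp_all add: v_mult)
    have nu: "nu F \<sigma> v n x = - 2 * \<alpha> - x"
      using 2 \<alpha> by (simp add: nu_M)
    \<comment> \<open>Right multiplication exchanges columns 1 and 3, where \<open>E\<close> takes
      opposite values; so the condition on either of these columns becomes the one on the other at
      the image point.\<close>
    have eq: "x / 2 - E x i - - \<alpha> = - (- 2 * \<alpha> - x) / 2 - E x i" "- x / 2 - E x i - \<alpha> = (- 2 * \<alpha> - x) / 2 - E x i"
      by (simp_all add: field_simps)
    show ?thesis
      unfolding forall_3 vm nu ereal_le_plus_iff E_simps eq by blast
  qed
  then show ?thesis
    unfolding V_nth bound_def by blast
qed

lemma P_shift:
  assumes "g \<in> SU3 F \<sigma>" "n \<in> N_grp F \<sigma>"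
  shows "mat_mult F g n \<in> P F \<sigma> v x \<longleftrightarrow> bound g x (nu F \<sigma> v n x)"
  using bound_shift[of g n x] N_grp_SU3[OF assms(2)] assms by (simp add: P_def)

lemma bound_refl: "bound (mat_one F) x x"
  by (auto simp: bound_def v_zero)

text \<open>\<open>dagger\<close> moves the entry (4 - j, 4 - i) to (i, j), and \<open>E\<close>
  changes sign under this reflection of indices, which exchanges the roles of \<open>x\<close> and
  \<open>y\<close>.\<close>

lemma bound_sym:
  assumes "g \<in> mats F" "bound g x y"
  shows "bound (dagger \<sigma> g) y x"
  unfolding bound_def
proof (intro allI)
  fix i j
  have "ereal (E y (4 - i) - E x (4 - j)) \<le> v (g $ (4 - j) $ (4 - i))"
    using assms by (simp only: bound_def)
  then show "ereal (E x j - E y i) \<le> v (dagger \<sigma> g $ i $ j)"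
    using assms by (simp add: E_reflect)
qed

text \<open>The contributions of the intermediate point cancel in every summand of the
  product.\<close>

lemma bound_trans:
  assumes "g \<in> mats F" "h \<in> mats F" "bound g x y" "bound h y z"
  shows "bound (mat_mult F g h) x z"
  unfolding bound_def
proof (intro allI)
  fix i j
  have "ereal (E z j - E x i) \<le> v (g $ i $ k \<otimes> h $ k $ j)" for k
  proof -
    have "ereal (E y k - E x i) + ereal (E z j - E y k) \<le> v (g $ i $ k \<otimes> h $ k $ j)"
      using assms by (intro v_mult_ge) (auto simp: bound_def)
    then show ?thesis
      by simp
  qed
  then show "ereal (E z j - E x i) \<le> v (mat_mult F g h $ i $ j)"
    using assms by (simp add: mat_mult_nth dot3_def v_add_ge)
qed

lemma bound_abs_le:
  assumes g: "g \<in> P F \<sigma> v 0" and b: "bound g x y"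
  shows "\<bar>y\<bar> \<le> \<bar>x\<bar>"
proof (rule ccontr)
  assume less: "\<not> \<bar>y\<bar> \<le> \<bar>x\<bar>"
  \<comment> \<open>The column where \<open>E y\<close> takes its maximum |y| / 2, which exceeds
    every value of \<open>E x\<close>.\<close>
  obtain j where "\<And>i. 0 < E y j - E x i"
  proof (cases "0 < y")
    case True
    have "0 < E y 1 - E x i" for i
      using exhaust_3[of i] less True by auto
    then show thesis
      by (rule that)
  next
    case False
    have "0 < E y 3 - E x i" for i
      using exhaust_3[of i] less False by auto
    then show thesis
      by (rule that)
  qed
  then have "0 < v (g $ i $ j)" for i
    using b by (metis bound_def ereal_less(2) order_less_le_trans)
  then have "0 < v (mat_det F g)"
    using g by (intro det_column_pos) (auto simp: P_iff)
  then show False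
    using g by (simp add: P_iff SU3_iff)
qed

lemma bound_abs_eq: "g \<in> P F \<sigma> v 0 \<Longrightarrow> bound g x y \<Longrightarrow> \<bar>x\<bar> = \<bar>y\<bar>"
  using bound_abs_le[of g x y] bound_abs_le[of "dagger \<sigma> g" y x] bound_sym[of g x y] by (simp add: P_iff)

lemma bound_zero: "g \<in> P F \<sigma> v 0 \<Longrightarrow> bound g 0 0"
  unfolding bound_def E_def by (simp add: P_iff flip: zero_ereal_def)

section \<open>Orbits of \<open>N\<close> on the real line\<close>

definition orbit :: "real \<Rightarrow> real \<Rightarrow> bool" where
  "orbit x y \<longleftrightarrow> (\<exists>n\<in>N_grp F \<sigma>. nu F \<sigma> v n x = y)"

lemma orbit_iff:
  "orbit x y \<longleftrightarrow> (\<exists>a\<in>carrier F - {\<zero>}. y = x - 2 * real_of_ereal (v a) \<or> y = - 2 * real_of_ereal (v a) - x)"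
proof -
  have "N_grp F \<sigma> = T_mat F \<sigma> ` (carrier F - {\<zero>}) \<union> M_mat F \<sigma> ` (carrier F - {\<zero>})"
    by (simp add: N_grp_def T_grp_def M_set_def)
  then have "orbit x y \<longleftrightarrow> (\<exists>a\<in>carrier F - {\<zero>}. nu F \<sigma> v (T_mat F \<sigma> a) x = y \<or> nu F \<sigma> v (M_mat F \<sigma> a) x = y)"
    unfolding orbit_def by auto
  then show ?thesis
    by (auto simp: nu_T nu_M)
qed

lemma real_v_mult:
  "a \<in> carrier F \<Longrightarrow> a \<noteq> \<zero> \<Longrightarrow> b \<in> carrier F \<Longrightarrow> b \<noteq> \<zero> \<Longrightarrow>
    real_of_ereal (v (a \<otimes> b)) = real_of_ereal (v a) + real_of_ereal (v b)"
  by (metis v_mult v_real plus_ereal.simps(1) real_of_ereal.simps(1))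

lemma real_v_inv:
  "a \<in> carrier F \<Longrightarrow> a \<noteq> \<zero> \<Longrightarrow> real_of_ereal (v (inv a)) = - real_of_ereal (v a)"
  by (simp add: v_inv)

lemma orbit_refl: "orbit x x"
  unfolding orbit_iff by (rule bexI[of _ \<one>]) auto

lemma orbit_minus: "orbit x (- x)"
  unfolding orbit_iff by (rule bexI[of _ \<one>]) auto

lemma orbit_sym:
  assumes "orbit x y"
  shows "orbit y x"
proof -
  obtain a where a: "a \<in> carrier F" "a \<noteq> \<zero>" "y = x - 2 * real_of_ereal (v a) \<or> y = - 2 * real_of_ereal (v a) - x"
    using assms by (auto simp: orbit_iff)
  from a(3) show ?thesis
  proof
    assume "y = x - 2 * real_of_ereal (v a)"
    then show ?thesis
      unfolding orbit_iff using a by (intro bexI[of _ "inv a"]) (auto simp: real_v_inv)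
  next
    assume "y = - 2 * real_of_ereal (v a) - x"
    then show ?thesis
      unfolding orbit_iff using a by (intro bexI[of _ a]) auto
  qed
qed

lemma orbit_trans:
  assumes "orbit x y" "orbit y z"
  shows "orbit x z"
proof -
  obtain a where a: "a \<in> carrier F" "a \<noteq> \<zero>" "y = x - 2 * real_of_ereal (v a) \<or> y = - 2 * real_of_ereal (v a) - x"
    using assms by (auto simp: orbit_iff)
  obtain b where b: "b \<in> carrier F" "b \<noteq> \<zero>" "z = y - 2 * real_of_ereal (v b) \<or> z = - 2 * real_of_ereal (v b) - y"
    using assms by (auto simp: orbit_iff)
  \<comment> \<open>Parameters of the composite map: the first if the second map is a translation,
    the other if it is a reflection.\<close>
  have ab: "a \<otimes> b \<in> carrier F - {\<zero>}" "b \<otimes> inv a \<in> carrier F - {\<zero>}"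
    using a b by (auto simp: integral_iff)
  from b(3) show ?thesis
  proof
    assume "z = y - 2 * real_of_ereal (v b)"
    then show ?thesis
      unfolding orbit_iff using a b ab by (intro bexI[OF _ ab(1)]) (auto simp: real_v_mult algebra_simps)
  next
    assume "z = - 2 * real_of_ereal (v b) - y"
    then show ?thesis
      unfolding orbit_iff using a b ab
      by (intro bexI[OF _ ab(2)]) (auto simp: real_v_mult real_v_inv algebra_simps)
  qed
qed

section \<open>The gluing relation of the tree as an equivalence relation\<close>

abbreviation "rel \<equiv> tree_rel F \<sigma> v"

text \<open>By \<open>P_shift\<close> an element \<open>n\<close> matters only through the value of
  \<open>nu\<close> at \<open>x\<close>, so its existence separates from the bound on the
  matrix.\<close>

lemma rel_iff:
  "((g, x), (h, y)) \<in> rel \<longleftrightarrow>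
    g \<in> SU3 F \<sigma> \<and> h \<in> SU3 F \<sigma> \<and> orbit x y \<and> bound (mat_mult F (dagger \<sigma> g) h) x y"
proof (cases "g \<in> SU3 F \<sigma> \<and> h \<in> SU3 F \<sigma>")
  case True
  then have "mat_mult F (dagger \<sigma> g) h \<in> SU3 F \<sigma>"
    by simp
  note P_shift[OF this]
  then have "(\<exists>n\<in>N_grp F \<sigma>. nu F \<sigma> v n x = y \<and> mat_mult F (mat_mult F (dagger \<sigma> g) h) n \<in> P F \<sigma> v x) \<longleftrightarrow>
      orbit x y \<and> bound (mat_mult F (dagger \<sigma> g) h) x y"
    unfolding orbit_def by blast
  then show ?thesis
    using True by (simp add: tree_rel_def glue_rel_def inv_SU3)
qed (auto simp: tree_rel_def glue_rel_def)

lemma equiv_rel: "equiv (SU3 F \<sigma> \<times> UNIV) rel"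
proof (rule equivI)
  show "rel \<subseteq> (SU3 F \<sigma> \<times> UNIV) \<times> (SU3 F \<sigma> \<times> UNIV)"
    by (auto simp: tree_rel_def glue_rel_def)
  show "refl_on (SU3 F \<sigma> \<times> UNIV) rel"
  proof (rule refl_onI)
    fix a assume "a \<in> SU3 F \<sigma> \<times> (UNIV :: real set)"
    then show "(a, a) \<in> rel"
      by (cases a) (auto simp: rel_iff orbit_refl bound_refl SU3_iff)
  qed
  show "sym rel"
  proof (rule symI)
    fix a b assume ab: "(a, b) \<in> rel"
    obtain g x h y where gh: "a = (g, x)" "b = (h, y)"
      by (cases a; cases b) auto
    have "bound (dagger \<sigma> (mat_mult F (dagger \<sigma> g) h)) y x"
      using ab by (intro bound_sym) (auto simp: gh rel_iff)
    then show "(b, a) \<in> rel"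
      using ab by (simp add: gh rel_iff orbit_sym dagger_mult)
  qed
  show "trans rel"
  proof (rule transI)
    fix a b c assume ab: "(a, b) \<in> rel" and bc: "(b, c) \<in> rel"
    obtain g x h y k z where gh: "a = (g, x)" "b = (h, y)" "c = (k, z)"
      by (cases a; cases b; cases c) auto
    have S: "g \<in> SU3 F \<sigma>" "h \<in> SU3 F \<sigma>" "k \<in> SU3 F \<sigma>"
      using ab bc by (auto simp: gh rel_iff)
    have "bound (mat_mult F (mat_mult F (dagger \<sigma> g) h) (mat_mult F (dagger \<sigma> h) k)) x z"
      using ab bc S by (intro bound_trans[of _ _ x y z]) (auto simp: gh rel_iff)
    moreover have "mat_mult F (mat_mult F (dagger \<sigma> g) h) (mat_mult F (dagger \<sigma> h) k) = mat_mult F (dagger \<sigma> g) k"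
      using S by (simp add: mat_mult_assoc)
    ultimately show "(a, c) \<in> rel"
      using ab bc orbit_trans by (auto simp: gh rel_iff)
  qed
qed

abbreviation "cls \<equiv> tree_class F \<sigma> v"

lemma cls_eq_iff:
  "g \<in> SU3 F \<sigma> \<Longrightarrow> h \<in> SU3 F \<sigma> \<Longrightarrow> cls g x = cls h y \<longleftrightarrow> ((g, x), (h, y)) \<in> rel"
  unfolding tree_class_def using equiv_rel by (intro eq_equiv_class_iff) auto

text \<open>For a matrix in \<open>P F \<sigma> v 0\<close> the bound forces |x| = |y|, and opposite
  points lie in one orbit; so the bound implies the orbit condition.\<close>

lemma cls_P_eq_iff:
  assumes "g \<in> P F \<sigma> v 0" "h \<in> P F \<sigma> v 0"
  shows "cls g x = cls h y \<longleftrightarrow> bound (mat_mult F (dagger \<sigma> g) h) x y"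
proof -
  have S: "g \<in> SU3 F \<sigma>" "h \<in> SU3 F \<sigma>" and q: "mat_mult F (dagger \<sigma> g) h \<in> P F \<sigma> v 0"
    using assms by (auto simp: P_iff)
  have "orbit x y" if "bound (mat_mult F (dagger \<sigma> g) h) x y"
    using bound_abs_eq[OF q that] orbit_refl[of x] orbit_minus[of x] by (auto simp: abs_eq_iff)
  then show ?thesis
    using S by (auto simp: cls_eq_iff rel_iff)
qed

section \<open>Distances from the base point and balls\<close>

lemma nu_surj_abs:
  assumes "n \<in> N_grp F \<sigma>"
  obtains y' where "nu F \<sigma> v n y' = y" "\<bar>y'\<bar> = \<bar>nu F \<sigma> v n 0 - y\<bar>"
  using assms
proof (cases rule: N_grp_cases)
  case (1 a)
  then show thesis
    using that[of "y + 2 * real_of_ereal (v a)"] by (simp add: nu_T)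
next
  case (2 a)
  then show thesis
    using that[of "- 2 * real_of_ereal (v a) - y"] by (simp add: nu_M)
qed

text \<open>An \<open>n\<close> moving 0 to \<open>x\<close> reparametrises the apartment of
  \<open>g\<close> so that the base point gets coordinate 0; the product of \<open>g\<close> and
  \<open>n\<close> then fixes the base point, which places it in
  \<open>P F \<sigma> v 0\<close>.\<close>

lemma normalise_representative:
  assumes g: "g \<in> SU3 F \<sigma>" and base: "cls (mat_one F) 0 = cls g x"
  obtains k z where "k \<in> P F \<sigma> v 0" "cls g y = cls k z" "\<bar>z\<bar> = \<bar>x - y\<bar>"
proof -
  have rel: "((mat_one F, 0), (g, x)) \<in> rel"
    using base g by (simp add: cls_eq_iff)
  then obtain n where n: "n \<in> N_grp F \<sigma>" "nu F \<sigma> v n 0 = x"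
    by (auto simp: rel_iff orbit_def)
  have nS: "n \<in> SU3 F \<sigma>"
    using n N_grp_SU3 by blast
  define k where "k = mat_mult F g n"
  have "bound g 0 (nu F \<sigma> v n 0)"
    using rel g n by (simp add: rel_iff)
  then have k: "k \<in> P F \<sigma> v 0"
    using P_shift[OF g n(1)] by (simp add: k_def)
  \<comment> \<open>\<open>nu F \<sigma> v n\<close> is a bijective isometry of the line taking 0 to
    \<open>x\<close>.\<close>
  obtain z where z: "nu F \<sigma> v n z = y" "\<bar>z\<bar> = \<bar>x - y\<bar>"
    using nu_surj_abs[OF n(1)] n(2) by metis
  have kS: "k \<in> SU3 F \<sigma>"
    using k by (simp add: P_iff)
  \<comment> \<open>The product of \<open>dagger \<sigma> k\<close> and \<open>g\<close> is the
    inverse of \<open>n\<close>, so \<open>bound_shift\<close> turns the trivial bound for the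
    identity into the one relating \<open>z\<close> and \<open>y\<close>.\<close>
  have "mat_mult F (mat_mult F (dagger \<sigma> k) g) n = mat_one F"
    using g nS kS by (simp add: mat_mult_assoc flip: k_def) (simp add: SU3_iff)
  then have "bound (mat_mult F (dagger \<sigma> k) g) z y"
    using bound_shift[of "mat_mult F (dagger \<sigma> k) g" n z] bound_refl[of z] g kS n(1) z(1)
    by (simp add: bound_def V_nth)
  then have "((k, z), (g, y)) \<in> rel"
    using g kS n(1) z(1) by (auto simp: rel_iff orbit_def)
  then have "cls g y = cls k z"
    using g kS cls_eq_iff by metis
  then show thesis
    using that k z by blast
qed

text \<open>The set under \<open>Inf\<close> is a singleton: \<open>normalise_representative\<close>
  rewrites any apartment through both points by an element of \<open>P F \<sigma> v 0\<close>, and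
  for such elements the absolute value of a coordinate depends on the point only.\<close>

lemma tree_dist_eq:
  assumes k: "k \<in> P F \<sigma> v 0"
  shows "tree_dist F \<sigma> v \<pi> (cls (mat_one F) 0) (cls k z) = ereal (\<bar>z\<bar> / e)"
proof -
  have kS: "k \<in> SU3 F \<sigma>"
    using k by (simp add: P_iff)
  have base: "cls (mat_one F) 0 = cls k 0"
    using k by (subst cls_P_eq_iff) (simp_all add: bound_zero P_iff)
  have "{ereal (\<bar>x - y\<bar> / e) | g x y. g \<in> SU3 F \<sigma> \<and> cls (mat_one F) 0 = cls g x \<and> cls k z = cls g y} = {ereal (\<bar>z\<bar> / e)}"
    (is "?S = _")
  proof (intro equalityI subsetI)
    fix d assume "d \<in> ?S"
    then obtain g x y where d: "d = ereal (\<bar>x - y\<bar> / e)" "g \<in> SU3 F \<sigma>" "cls (mat_one F) 0 = cls g x" "cls k z = cls g y"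
      by blast
    obtain k' z' where k': "k' \<in> P F \<sigma> v 0" "cls g y = cls k' z'" "\<bar>z'\<bar> = \<bar>x - y\<bar>"
      using normalise_representative[OF d(2,3)] .
    have "bound (mat_mult F (dagger \<sigma> k) k') z z'"
      using d(4) k'(2) cls_P_eq_iff[OF k k'(1)] by metis
    then have "\<bar>z\<bar> = \<bar>z'\<bar>"
      using k k'(1) by (intro bound_abs_eq) auto
    then show "d \<in> {ereal (\<bar>z\<bar> / e)}"
      using d(1) k'(3) by simp
  next
    fix d assume "d \<in> {ereal (\<bar>z\<bar> / e)}"
    then have "d = ereal (\<bar>0 - z\<bar> / e)"
      by simp
    then show "d \<in> ?S"
      using kS base by blast
  qed
  then show ?thesis
    unfolding tree_dist_def e_def[symmetric] by simp
qed

abbreviation "I \<equiv> trunc_interval F v \<pi> r"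

lemma I_iff: "x \<in> I \<longleftrightarrow> \<bar>x\<bar> \<le> real r * e"
  by (auto simp: trunc_interval_eq)

lemma tree_ball_eq: "tree_ball F \<sigma> v \<pi> r = {cls g x | g x. g \<in> P F \<sigma> v 0 \<and> x \<in> I}"
proof (intro equalityI subsetI)
  fix b assume b: "b \<in> tree_ball F \<sigma> v \<pi> r"
  then have dist: "tree_dist F \<sigma> v \<pi> (cls (mat_one F) 0) b \<le> ereal (real r)"
    by (simp add: tree_ball_def)
  \<comment> \<open>Without a common apartment the infimum would be taken over the empty set and be
    infinite.\<close>
  have "\<exists>g x y. g \<in> SU3 F \<sigma> \<and> cls (mat_one F) 0 = cls g x \<and> b = cls g y"
  proof (rule ccontr)
    assume "\<not> ?thesis"
    then have "{ereal (\<bar>x - y\<bar> / real_of_ereal (v \<pi>)) | g x y.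
        g \<in> SU3 F \<sigma> \<and> cls (mat_one F) 0 = cls g x \<and> b = cls g y} = {}"
      by blast
    then have "tree_dist F \<sigma> v \<pi> (cls (mat_one F) 0) b = \<infinity>"
      unfolding tree_dist_def by (simp only: Inf_empty top_ereal_def)
    then show False
      using dist by simp
  qed
  then obtain g x y where g: "g \<in> SU3 F \<sigma>" "cls (mat_one F) 0 = cls g x" "b = cls g y"
    by blast
  obtain k z where k: "k \<in> P F \<sigma> v 0" "cls g y = cls k z"
    using normalise_representative[OF g(1,2)] by metis
  have "\<bar>z\<bar> / e \<le> real r"
    using dist tree_dist_eq[OF k(1)] g(3) k(2) by simp
  then have "z \<in> I"
    using pi_facts by (simp add: I_iff divide_simps)
  then show "b \<in> {cls g x | g x. g \<in> P F \<sigma> v 0 \<and> x \<in> I}"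
    using g k by blast
next
  fix b assume "b \<in> {cls g x | g x. g \<in> P F \<sigma> v 0 \<and> x \<in> I}"
  then obtain g x where g: "b = cls g x" "g \<in> P F \<sigma> v 0" "x \<in> I"
    by blast
  then have "cls g x \<in> tree F \<sigma> v"
    unfolding tree_def tree_class_def by (intro quotientI) (simp add: P_iff)
  moreover have "\<bar>x\<bar> / e \<le> real r"
    using g(3) pi_facts by (simp add: I_iff divide_simps)
  ultimately show "b \<in> tree_ball F \<sigma> v \<pi> r"
    using g by (simp add: tree_ball_def tree_dist_eq)
qed

end


section \<open>Comparison with the local version\<close>

context truncation
begin

abbreviation "lrel \<equiv> loc_rel F \<sigma> v \<pi> r"
abbreviation "lcls \<equiv> loc_class F \<sigma> v \<pi> r"
abbreviation "\<tau> \<equiv> (`) \<sigma>"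

text \<open>Valuation 0 is visible modulo a positive power of the maximal ideal; for
  \<open>r = 0\<close> the only class has valuation infinity.\<close>

lemma interval_params_pr:
  assumes "0 < r"
  shows "{C \<in> carrier Rr. trunc_val F v r C = 0} = pr ` {x \<in> carrier F. v x = 0}"
proof (intro equalityI subsetI)
  fix Y assume "Y \<in> {C \<in> carrier Rr. trunc_val F v r C = 0}"
  then have Y: "Y \<in> carrier Rr" "trunc_val F v r Y = 0"
    by auto
  obtain x where x: "x \<in> carrier F" "0 \<le> v x" "Y = pr x"
    using pr_surj[OF Y(1)] by auto
  then have "v x = 0"
    using Y(2) by (simp add: trunc_val_pr split: if_splits)
  then show "Y \<in> pr ` {x \<in> carrier F. v x = 0}"
    using x by auto
next
  fix Y assume "Y \<in> pr ` {x \<in> carrier F. v x = 0}"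
  then obtain x where x: "x \<in> carrier F" "v x = 0" "Y = pr x"
    by auto
  moreover have "\<not> ereal (real r * e) \<le> 0"
    using assms pi_facts by (simp add: not_le)
  ultimately show "Y \<in> {C \<in> carrier Rr. trunc_val F v r C = 0}"
    by (simp add: trunc_val_pr)
qed

lemma H_loc_eq:
  assumes "0 < r"
  shows "H_loc F \<sigma> v r = red ` T_mat F \<sigma> ` {x \<in> carrier F. v x = 0}"
proof -
  have "red (T_mat F \<sigma> x) = T_mat Rr \<tau> (pr x)" "T_mat Rr \<tau> (pr x) \<in> carrier (SL3 Rr)"
    if "x \<in> carrier F" "v x = 0" for x
    using red_T[OF that] red_SU3 by (metis, metis Rr.SU3_SL3)
  then show ?thesis
    unfolding H_loc_def interval_params_pr[OF assms] by (auto simp: image_image)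
qed

lemma M_loc_eq:
  assumes "0 < r"
  shows "M_loc F \<sigma> v r = red ` M_mat F \<sigma> ` {x \<in> carrier F. v x = 0}"
proof -
  have "red (M_mat F \<sigma> x) = M_mat Rr \<tau> (pr x)" "M_mat Rr \<tau> (pr x) \<in> carrier (SL3 Rr)"
    if "x \<in> carrier F" "v x = 0" for x
    using red_M[OF that] red_SU3 by (metis, metis Rr.SU3_SL3)
  then show ?thesis
    unfolding M_loc_def interval_params_pr[OF assms] by (auto simp: image_image)
qed

lemma nu_loc_T:
  assumes "x \<in> carrier F" "v x = 0" "0 < r"
  shows "nu_loc F \<sigma> v r (red (T_mat F \<sigma> x)) y = y"
proof -
  have ne: "pr x \<noteq> \<zero>\<^bsub>Rr\<^esub>"
    using assms pi_facts by (simp add: pr_zero_iff not_le)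
  \<comment> \<open>As for \<open>nu\<close>, the case distinction in \<open>nu_loc\<close> is
    settled by the entry (1,1), which stays nonzero after reduction because
    \<open>0 < r\<close>.\<close>
  have "red (T_mat F \<sigma> x) \<notin> M_loc F \<sigma> v r"
  proof
    assume "red (T_mat F \<sigma> x) \<in> M_loc F \<sigma> v r"
    then obtain y where "red (T_mat F \<sigma> x) = red (M_mat F \<sigma> y)"
      using M_loc_eq[OF assms(3)] by auto
    then have "red (T_mat F \<sigma> x) $ 1 $ 1 = red (M_mat F \<sigma> y) $ 1 $ 1"
      by simp
    then show False
      using ne pr.hom_zero by (simp add: T_mat_def M_mat_def)
  qed
  then show ?thesis
    by (simp add: nu_loc_def)
qed

lemma nu_loc_M:
  assumes "x \<in> carrier F" "v x = 0" "0 < r"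
  shows "nu_loc F \<sigma> v r (red (M_mat F \<sigma> x)) y = - y"
  using M_loc_eq[OF assms(3)] assms by (auto simp: nu_loc_def reflection_def)

text \<open>Reduction alters valuations only from \<open>real r * e\<close> upwards, and no entry of
  \<open>V x\<close> exceeds that value for \<open>x\<close> in the interval.\<close>

lemma red_P_loc_iff:
  assumes g: "g \<in> P F \<sigma> v 0" and x: "x \<in> I"
  shows "red g \<in> P_loc F \<sigma> v r x \<longleftrightarrow> g \<in> P F \<sigma> v x"
proof -
  have "ereal (V x $ i $ j) \<le> trunc_val F v r (pr (g $ i $ j)) \<longleftrightarrow> ereal (V x $ i $ j) \<le> v (g $ i $ j)" for i j
  proof -
    have "V x $ i $ j \<le> \<bar>x\<bar>"
      unfolding V_nth using exhaust_3[of i] exhaust_3[of j] by (elim disjE) auto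
    then have "ereal (V x $ i $ j) \<le> ereal (real r * e)"
      using x by (simp add: I_iff)
    note order_trans[OF this, of "v (g $ i $ j)"]
    then show ?thesis
      using g by (auto simp: P_iff trunc_val_pr)
  qed
  then show ?thesis
    using g red_SU3[OF g] by (simp add: P_loc_def P_iff) (simp add: P_def)
qed

text \<open>The local gluing relation is the image of that of the tree: an element of \<open>N\<close> relating two
  points with representatives in \<open>P\<^sub>0\<close> may be replaced by one with unit parameter, as the two
  real coordinates agree up to sign.\<close>

lemma lrel_iff:
  assumes g: "g \<in> P F \<sigma> v 0" and h: "h \<in> P F \<sigma> v 0" and x: "x \<in> I" and y: "y \<in> I" and r: "0 < r"
  shows "((red g, x), (red h, y)) \<in> lrel \<longleftrightarrow> cls g x = cls h y"
proof -
  define q where "q = mat_mult F (dagger \<sigma> g) h"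
  have q: "q \<in> P F \<sigma> v 0"
    using g h by (simp add: q_def)
  then have qS: "q \<in> SU3 F \<sigma>"
    by (simp add: P_iff)
  have N: "N_loc F \<sigma> v r = red ` (T_mat F \<sigma> ` {x \<in> carrier F. v x = 0} \<union> M_mat F \<sigma> ` {x \<in> carrier F. v x = 0})"
    unfolding N_loc_def H_loc_eq[OF r] M_loc_eq[OF r] by blast
  have "((red g, x), (red h, y)) \<in> lrel \<longleftrightarrow>
      (\<exists>n\<in>N_loc F \<sigma> v r. nu_loc F \<sigma> v r n x = y \<and> mat_mult Rr (red q) n \<in> P_loc F \<sigma> v r x)"
    using g h x y red_SU3 by (simp add: loc_rel_def glue_rel_def P_loc_zero Rr.inv_SU3 q_def red_mult red_dagger P_iff)
  also have "\<dots> \<longleftrightarrow> (\<exists>a\<in>{a \<in> carrier F. v a = 0}.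
      nu_loc F \<sigma> v r (red (T_mat F \<sigma> a)) x = y \<and> mat_mult Rr (red q) (red (T_mat F \<sigma> a)) \<in> P_loc F \<sigma> v r x \<or>
      nu_loc F \<sigma> v r (red (M_mat F \<sigma> a)) x = y \<and> mat_mult Rr (red q) (red (M_mat F \<sigma> a)) \<in> P_loc F \<sigma> v r x)"
    unfolding N by blast
  also have "\<dots> \<longleftrightarrow> (\<exists>a\<in>{a \<in> carrier F. v a = 0}.
      x = y \<and> mat_mult Rr (red q) (red (T_mat F \<sigma> a)) \<in> P_loc F \<sigma> v r x \<or>
      - x = y \<and> mat_mult Rr (red q) (red (M_mat F \<sigma> a)) \<in> P_loc F \<sigma> v r x)"
    by (rule bex_cong[OF refl]) (simp add: nu_loc_T nu_loc_M r)
  \<comment> \<open>For a unit \<open>a\<close> the maps \<open>nu\<close> are the identity and the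
    reflection through 0, so \<open>P_shift\<close> turns both memberships into the same
    bound.\<close>
  also have "\<dots> \<longleftrightarrow> (\<exists>a\<in>{a \<in> carrier F. v a = 0}. (x = y \<or> - x = y) \<and> bound q x y)"
  proof (rule bex_cong[OF refl])
    fix a assume "a \<in> {a \<in> carrier F. v a = 0}"
    then have a: "a \<in> carrier F" "v a = 0"
      by auto
    have "mat_mult Rr (red q) (red n) \<in> P_loc F \<sigma> v r x \<longleftrightarrow> bound q x (nu F \<sigma> v n x)"
      if n: "n \<in> P F \<sigma> v 0" "n \<in> N_grp F \<sigma>" for n
    proof -
      have "mat_mult Rr (red q) (red n) = red (mat_mult F q n)"
        using n q by (simp add: red_mult P_iff)
      then show ?thesis
        using red_P_loc_iff[of "mat_mult F q n" x] P_shift[OF qS n(2), of x] q n x by simp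
    qed
    note shift = this
    have nz: "a \<noteq> \<zero>"
      using a v_zero_nonzero by blast
    have "T_mat F \<sigma> a \<in> N_grp F \<sigma>" "M_mat F \<sigma> a \<in> N_grp F \<sigma>"
      using a nz by (auto simp: N_grp_def T_grp_def M_set_def)
    then show "x = y \<and> mat_mult Rr (red q) (red (T_mat F \<sigma> a)) \<in> P_loc F \<sigma> v r x \<or>
      - x = y \<and> mat_mult Rr (red q) (red (M_mat F \<sigma> a)) \<in> P_loc F \<sigma> v r x \<longleftrightarrow>
      (x = y \<or> - x = y) \<and> bound q x y"
      using shift[of "T_mat F \<sigma> a"] shift[of "M_mat F \<sigma> a"] red_T(1)[OF a] red_M(1)[OF a] a nz
      by (auto simp: nu_T nu_M)
  qed
  \<comment> \<open>The parameter has dropped out, and 1 shows that one exists.\<close>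
  also have "\<dots> \<longleftrightarrow> (x = y \<or> - x = y) \<and> bound q x y"
    by (auto intro: bexI[of _ \<one>])
  also have "\<dots> \<longleftrightarrow> bound q x y"
    using bound_abs_eq[OF q, of x y] by (auto simp: abs_eq_iff)
  also have "\<dots> \<longleftrightarrow> cls g x = cls h y"
    using cls_P_eq_iff[OF g h] by (simp add: q_def)
  finally show ?thesis .
qed

text \<open>The only class of the trivial ring has valuation infinity, so \<open>N_loc\<close> is
  empty and no point is related to any other, nor to itself; the quotient still has one element, the
  empty set.\<close>

lemma lcls_r_zero:
  assumes "r = 0"
  shows "lcls G x = {}"
proof -
  have "trunc_val F v r C \<noteq> 0" if C: "C \<in> carrier Rr" for C
  proof -
    obtain x where "x \<in> carrier F" "0 \<le> v x" "C = pr x"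
      using pr_surj[OF C] by auto
    then show ?thesis
      using trunc_val_pr[of x] assms by (simp flip: zero_ereal_def)
  qed
  then have "N_loc F \<sigma> v r = {}"
    by (auto simp: N_loc_def H_loc_def M_loc_def)
  then show ?thesis
    by (simp add: loc_class_def loc_rel_def glue_rel_def)
qed

lemma lcls_eq_iff:
  assumes g: "g \<in> P F \<sigma> v 0" and h: "h \<in> P F \<sigma> v 0" and x: "x \<in> I" and y: "y \<in> I"
  shows "lcls (red g) x = lcls (red h) y \<longleftrightarrow> cls g x = cls h y"
proof (cases "r = 0")
  case True
  \<comment> \<open>The interval is {0}: the local classes are all empty, and all elements of
    \<open>P F \<sigma> v 0\<close> give the same base point.\<close>
  then have "x = 0" "y = 0"
    using I_iff[of x] I_iff[of y] x y by auto
  then show ?thesis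
    using g h True lcls_r_zero by (simp add: cls_P_eq_iff bound_zero)
next
  case False
  then have r: "0 < r"
    by simp
  \<comment> \<open>By \<open>red_image\<close> both members of a related pair lift to
    \<open>P F \<sigma> v 0\<close>.\<close>
  have sub: "lrel \<subseteq> (red ` P F \<sigma> v 0 \<times> I) \<times> (red ` P F \<sigma> v 0 \<times> I)"
    by (auto simp: loc_rel_def glue_rel_def P_loc_zero red_image)
  \<comment> \<open>Local classes are images of classes of the tree, so the equivalence relation is
    inherited from there.\<close>
  have class_eq: "lcls (red k) z = {(red l, w) | l w. l \<in> P F \<sigma> v 0 \<and> w \<in> I \<and> cls k z = cls l w}"
    if k: "k \<in> P F \<sigma> v 0" "z \<in> I" for k z
  proof (intro equalityI subsetI)
    fix c assume c: "c \<in> lcls (red k) z"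
    then have "((red k, z), c) \<in> lrel"
      by (simp add: loc_class_def)
    moreover from this obtain l w where "l \<in> P F \<sigma> v 0" "w \<in> I" "c = (red l, w)"
      using sub by auto
    ultimately show "c \<in> {(red l, w) | l w. l \<in> P F \<sigma> v 0 \<and> w \<in> I \<and> cls k z = cls l w}"
      using lrel_iff[OF k(1) _ k(2) _ r] by auto
  next
    fix c assume "c \<in> {(red l, w) | l w. l \<in> P F \<sigma> v 0 \<and> w \<in> I \<and> cls k z = cls l w}"
    then obtain l w where "l \<in> P F \<sigma> v 0" "w \<in> I" "cls k z = cls l w" "c = (red l, w)"
      by auto
    then show "c \<in> lcls (red k) z"
      using lrel_iff[OF k(1) _ k(2) _ r] by (simp add: loc_class_def)
  qed
  show ?thesis
  proof
    assume eq: "lcls (red g) x = lcls (red h) y"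
    have "(red h, y) \<in> lcls (red h) y"
      using class_eq[OF h y] h y by blast
    then have "((red g, x), (red h, y)) \<in> lrel"
      unfolding eq[symmetric] by (simp add: loc_class_def)
    then show "cls g x = cls h y"
      using lrel_iff[OF g h x y r] by simp
  next
    assume "cls g x = cls h y"
    then show "lcls (red g) x = lcls (red h) y"
      using class_eq[OF g x] class_eq[OF h y] by simp
  qed
qed

section \<open>Equivariance and the bijection\<close>

lemma red_hom:
  "red \<in> hom ((SL3 F)\<lparr>carrier := P F \<sigma> v 0\<rparr>) ((SL3 Rr)\<lparr>carrier := P_loc F \<sigma> v r 0\<rparr>)"
  by (rule homI) (auto simp: P_loc_zero red_SU3 red_mult P_iff SL3_def)

lemma left_act_cls:
  assumes "k \<in> P F \<sigma> v 0" "g \<in> P F \<sigma> v 0"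
  shows "left_act (SL3 F) k (cls g x) = cls (mat_mult F k g) x"
  using left_act_glue_class[OF SL3_group SU3_subgroup, of k g] assms
  unfolding tree_class_def tree_rel_def by (simp add: P_iff)

lemma left_act_lcls:
  assumes "k \<in> P F \<sigma> v 0" "g \<in> P F \<sigma> v 0"
  shows "left_act (SL3 Rr) (red k) (lcls (red g) x) = lcls (red (mat_mult F k g)) x"
  using left_act_glue_class[OF Rr.SL3_group Rr.SU3_subgroup, of "red k" "red g"] assms red_SU3
  unfolding loc_class_def loc_rel_def P_loc_zero by (simp add: P_iff red_mult)

lemma ball_isomorphism:
  "\<exists>f. (\<forall>g\<in>P F \<sigma> v 0. \<forall>x\<in>I. f (cls g x) = lcls (red g) x) \<and>
     bij_betw f (tree_ball F \<sigma> v \<pi> r) (loc F \<sigma> v \<pi> r) \<and>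
     (\<forall>k\<in>P F \<sigma> v 0. \<forall>b\<in>tree_ball F \<sigma> v \<pi> r.
        left_act (SL3 F) k b \<in> tree_ball F \<sigma> v \<pi> r \<and>
        f (left_act (SL3 F) k b) = left_act (SL3 Rr) (red k) (f b))"
proof -
  \<comment> \<open>A representative is chosen; \<open>lcls_eq_iff\<close> makes the value
    independent of the choice in one direction and gives injectivity in the other.\<close>
  define f where "f b = (SOME c. \<exists>g x. g \<in> P F \<sigma> v 0 \<and> x \<in> I \<and> b = cls g x \<and> c = lcls (red g) x)" for b
  have f: "f (cls g x) = lcls (red g) x" if gx: "g \<in> P F \<sigma> v 0" "x \<in> I" for g x
  proof -
    have "\<exists>c h y. h \<in> P F \<sigma> v 0 \<and> y \<in> I \<and> cls g x = cls h y \<and> c = lcls (red h) y"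
      using gx by blast
    from someI_ex[OF this] obtain h y where
      "h \<in> P F \<sigma> v 0" "y \<in> I" "cls g x = cls h y" "f (cls g x) = lcls (red h) y"
      unfolding f_def by blast
    then show ?thesis
      using lcls_eq_iff gx by metis
  qed
  \<comment> \<open>Surjectivity rests on \<open>red_image\<close>: every local group element is a
    reduction.\<close>
  have loc: "loc F \<sigma> v \<pi> r = {lcls (red g) x | g x. g \<in> P F \<sigma> v 0 \<and> x \<in> I}"
    unfolding loc_def quotient_def P_loc_zero loc_class_def red_image[symmetric] by blast
  have "bij_betw f (tree_ball F \<sigma> v \<pi> r) (loc F \<sigma> v \<pi> r)"
    unfolding bij_betw_def
  proof
    show "inj_on f (tree_ball F \<sigma> v \<pi> r)"
    proof (rule inj_onI)
      fix b c assume "b \<in> tree_ball F \<sigma> v \<pi> r" "c \<in> tree_ball F \<sigma> v \<pi> r" and eq: "f b = f c"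
      then obtain g x h y where b: "g \<in> P F \<sigma> v 0" "x \<in> I" "b = cls g x" and c: "h \<in> P F \<sigma> v 0" "y \<in> I" "c = cls h y"
        unfolding tree_ball_eq by blast
      then show "b = c"
        using eq f[OF b(1,2)] f[OF c(1,2)] lcls_eq_iff[OF b(1) c(1) b(2) c(2)] by metis
    qed
    show "f ` tree_ball F \<sigma> v \<pi> r = loc F \<sigma> v \<pi> r"
      unfolding tree_ball_eq loc using f by force
  qed
  moreover have "left_act (SL3 F) k b \<in> tree_ball F \<sigma> v \<pi> r \<and>
      f (left_act (SL3 F) k b) = left_act (SL3 Rr) (red k) (f b)"
    if k: "k \<in> P F \<sigma> v 0" and b: "b \<in> tree_ball F \<sigma> v \<pi> r" for k b
  proof -
    obtain g x where gx: "g \<in> P F \<sigma> v 0" "x \<in> I" "b = cls g x"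
      using b unfolding tree_ball_eq by blast
    have kg: "mat_mult F k g \<in> P F \<sigma> v 0"
      using k gx by simp
    have act: "left_act (SL3 F) k b = cls (mat_mult F k g) x"
      unfolding gx(3) by (rule left_act_cls[OF k gx(1)])
    then have "left_act (SL3 F) k b \<in> tree_ball F \<sigma> v \<pi> r"
      unfolding tree_ball_eq using kg gx(2) by blast
    moreover have "f (left_act (SL3 F) k b) = left_act (SL3 Rr) (red k) (f b)"
      unfolding act f[OF kg gx(2)] unfolding gx(3) f[OF gx(1,2)]
      by (rule left_act_lcls[OF k gx(1), symmetric])
    ultimately show ?thesis ..
  qed
  ultimately show ?thesis
    using f by (intro exI[of _ f]) simp
qed

end

theorem theorem6p23:
  fixes L :: "('a, 'm) ring_scheme" and K :: "'a set"
    and \<omega> :: "'a \<Rightarrow> ereal" and \<sigma> :: "'a \<Rightarrow> 'a" and \<pi> :: 'a and r :: nat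
  assumes "ramified_quadratic_extension L \<omega> K \<sigma>"
    and "uniformiser L \<omega> \<pi>"
  shows "tree_ball L \<sigma> \<omega> \<pi> r =
           {tree_class L \<sigma> \<omega> g x | g x. g \<in> P L \<sigma> \<omega> 0 \<and> x \<in> trunc_interval L \<omega> \<pi> r} \<and>
         p_red L \<omega> r \<in> hom ((SL3 L)\<lparr>carrier := P L \<sigma> \<omega> 0\<rparr>)
                           ((SL3 (trunc_ring L \<omega> r))\<lparr>carrier := P_loc L \<sigma> \<omega> r 0\<rparr>) \<and>
         (\<exists>f. (\<forall>g\<in>P L \<sigma> \<omega> 0. \<forall>x\<in>trunc_interval L \<omega> \<pi> r.
                 f (tree_class L \<sigma> \<omega> g x) = loc_class L \<sigma> \<omega> \<pi> r (p_red L \<omega> r g) x) \<and>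
             bij_betw f (tree_ball L \<sigma> \<omega> \<pi> r) (loc L \<sigma> \<omega> \<pi> r) \<and>
             (\<forall>k\<in>P L \<sigma> \<omega> 0. \<forall>b\<in>tree_ball L \<sigma> \<omega> \<pi> r.
                 left_act (SL3 L) k b \<in> tree_ball L \<sigma> \<omega> \<pi> r \<and>
                 f (left_act (SL3 L) k b) =
                   left_act (SL3 (trunc_ring L \<omega> r)) (p_red L \<omega> r k) (f b)))"
proof -
  interpret truncation L \<omega> K \<sigma> \<pi> r
    using assms by (simp add: truncation_def truncation_axioms_def)
  show ?thesis
    using tree_ball_eq red_hom ball_isomorphism by blast
qed

end
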